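(* There are infinitely many parameter $2$ non-synchronizing groups; that is, there are infinitely many finite primitive non-synchronizing permutation groups $G$ with $m(G)=2$.
   Context: Let $G$ be a primitive permutation group on a finite set $X$ with $|X|=n$, acting on the right. A set $S\subseteq X$ is a $G$-regular section for a partition $P$ of $X$ if $|Sg\cap T|=1$ for every $g\in G$ and every part $T$ of $P$. A non-synchronizing partition for $G$ is a partition $P$ of $X$ which has a $G$-regular section $S$ with $1<|S|<n$. $G$ is non-synchronizing if it has a non-synchronizing partition. For $S\subseteq X$ with $1<|S|<n$, let $\Gamma_S$ be the graph on $X$ in which distinct $x,y$ are adjacent iff there is $g\in G$ with $\{xg,yg\}\subseteq S$; let $\overline{\Gamma}_S$ be its complement. The closed neighbourhood of $x$ in $\overline{\Gamma}_S$ is $x$ together with all its neighbours. If $T$ is a clique of $\overline{\Gamma}_S$ which meets every translate $Sg$ ($g\in G$), then $m(S,T)$ is the smallest number $m$ such that the intersection of the closed neighbourhoods in $\overline{\Gamma}_S$ of any $m$ points of $T$ equals $T$; equivalently, $m(S,T)$ is one more than the maximum number of neighbours in $T$, in the graph $\overline{\Gamma}_S$, of a point outside $T$. For a non-synchronizing group $G$, $m(G)$ is the maximum of $m(S,T)$ over all pairs $(S,T)$ such that $T$ is a part of a non-synchronizing partition $P$ for which $S$ is a $G$-regular section (with $1<|S|<n$). Infinitely many means infinitely many up to permutation isomorphism. *)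

theory Defs
  imports "HOL-Algebra.Group_Action" "HOL-Library.Disjoint_Sets"
begin

text \<open>
  A permutation group on \<open>X\<close> is given by the set \<open>G\<close> of its elements, a subgroup of \<open>BijGroup X\<close>.
  The image of a point under \<open>g\<close> is \<open>g x\<close> (written $xg$ in the right-action convention) and the
  translate $Sg$ is \<open>g ` S\<close>. None of the notions below depends on the order of composition.
\<close>

definition perm_group :: "'a set \<Rightarrow> ('a \<Rightarrow> 'a) set \<Rightarrow> bool" where
  "perm_group X G \<longleftrightarrow> subgroup G (BijGroup X)"

abbreviation as_group :: "'a set \<Rightarrow> ('a \<Rightarrow> 'a) set \<Rightarrow> ('a \<Rightarrow> 'a) monoid" where
  "as_group X G \<equiv> (BijGroup X)\<lparr>carrier := G\<rparr>"

definition primitive_perm_group :: "'a set \<Rightarrow> ('a \<Rightarrow> 'a) set \<Rightarrow> bool" where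
  "primitive_perm_group X G \<longleftrightarrow>
     perm_group X G \<and>
     transitive_action (as_group X G) X (\<lambda>g. g) \<and>
     (\<forall>P. partition_on X P \<and> (\<forall>g\<in>G. \<forall>T\<in>P. g ` T \<in> P) \<longrightarrow>
          P = {X} \<or> P = (\<lambda>x. {x}) ` X)"

definition regular_section :: "'a set \<Rightarrow> ('a \<Rightarrow> 'a) set \<Rightarrow> 'a set \<Rightarrow> 'a set set \<Rightarrow> bool" where
  "regular_section X G S P \<longleftrightarrow>
     S \<subseteq> X \<and> (\<forall>g\<in>G. \<forall>T\<in>P. card (g ` S \<inter> T) = 1)"

definition nonsync_partition_via ::
  "'a set \<Rightarrow> ('a \<Rightarrow> 'a) set \<Rightarrow> 'a set \<Rightarrow> 'a set set \<Rightarrow> bool" where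
  "nonsync_partition_via X G S P \<longleftrightarrow>
     partition_on X P \<and> regular_section X G S P \<and> 1 < card S \<and> card S < card X"

definition nonsync_partition :: "'a set \<Rightarrow> ('a \<Rightarrow> 'a) set \<Rightarrow> 'a set set \<Rightarrow> bool" where
  "nonsync_partition X G P \<longleftrightarrow> (\<exists>S. nonsync_partition_via X G S P)"

definition non_synchronizing :: "'a set \<Rightarrow> ('a \<Rightarrow> 'a) set \<Rightarrow> bool" where
  "non_synchronizing X G \<longleftrightarrow> (\<exists>P. nonsync_partition X G P)"

text \<open>Simple graphs on \<open>X\<close> are represented by their symmetric irreflexive adjacency relations.\<close>

definition section_graph :: "'a set \<Rightarrow> ('a \<Rightarrow> 'a) set \<Rightarrow> 'a set \<Rightarrow> ('a \<times> 'a) set" where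
  "section_graph X G S =
     {(x, y). x \<in> X \<and> y \<in> X \<and> x \<noteq> y \<and> (\<exists>g\<in>G. {g x, g y} \<subseteq> S)}"

definition graph_complement :: "'a set \<Rightarrow> ('a \<times> 'a) set \<Rightarrow> ('a \<times> 'a) set" where
  "graph_complement X E = {(x, y). x \<in> X \<and> y \<in> X \<and> x \<noteq> y \<and> (x, y) \<notin> E}"

definition closed_nbhd :: "('a \<times> 'a) set \<Rightarrow> 'a \<Rightarrow> 'a set" where
  "closed_nbhd E x = insert x (E `` {x})"

text \<open>
  \<open>pair_parameter X G S T\<close> is $m(S,T)$. It is meaningful when \<open>T\<close> is a clique of the complement of
  \<open>section_graph X G S\<close> meeting every translate of \<open>S\<close>, as parts of non-synchronizing partitions with
  section \<open>S\<close> are; then \<open>m = card T\<close> has the required property, so the minimum exists.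
  Intersections are taken within \<open>X\<close>, which matters only for the empty intersection (\<open>m = 0\<close>).
\<close>

definition pair_parameter :: "'a set \<Rightarrow> ('a \<Rightarrow> 'a) set \<Rightarrow> 'a set \<Rightarrow> 'a set \<Rightarrow> nat" where
  "pair_parameter X G S T =
     (LEAST m. \<forall>A. A \<subseteq> T \<and> card A = m \<longrightarrow>
        X \<inter> (\<Inter>x\<in>A. closed_nbhd (graph_complement X (section_graph X G S)) x) = T)"

text \<open>
  $m(G)$. For finite \<open>X\<close> and non-synchronizing \<open>G\<close>, \<open>Max\<close> is taken over a finite nonempty set.
\<close>

definition group_parameter :: "'a set \<Rightarrow> ('a \<Rightarrow> 'a) set \<Rightarrow> nat" where
  "group_parameter X G =
     Max {pair_parameter X G S T | S T. \<exists>P. nonsync_partition_via X G S P \<and> T \<in> P}"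

definition perm_isomorphic ::
  "'a set \<Rightarrow> ('a \<Rightarrow> 'a) set \<Rightarrow> 'b set \<Rightarrow> ('b \<Rightarrow> 'b) set \<Rightarrow> bool" where
  "perm_isomorphic X G Y H \<longleftrightarrow>
     perm_group X G \<and> perm_group Y H \<and>
     (\<exists>f \<phi>. bij_betw f X Y \<and> \<phi> \<in> iso (as_group X G) (as_group Y H) \<and>
        (\<forall>g\<in>G. \<forall>x\<in>X. f (g x) = \<phi> g (f x)))"

definition perm_iso_rel ::
  "(('a set \<times> ('a \<Rightarrow> 'a) set) \<times> ('a set \<times> ('a \<Rightarrow> 'a) set)) set" where
  "perm_iso_rel = {((X, G), (Y, H)). perm_isomorphic X G Y H}"

lemma perm_group_maps_to: "perm_group X G \<Longrightarrow> g \<in> G \<Longrightarrow> x \<in> X \<Longrightarrow> g x \<in> X"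
  using Bij_imp_funcset[of g X] subgroup.subset[of G "BijGroup X"]
  by (auto simp: perm_group_def BijGroup_def)

lemma perm_isomorphic_refl: "perm_group X G \<Longrightarrow> perm_isomorphic X G X G"
  unfolding perm_isomorphic_def
  by (intro conjI exI[of _ "\<lambda>x. x"]) (auto simp: iso_set_refl bij_betw_def)

lemma perm_isomorphic_sym:
  assumes "perm_isomorphic X G Y H"
  shows "perm_isomorphic Y H X G"
proof -
  from assms obtain f \<phi> where G: "perm_group X G" and H: "perm_group Y H"
    and f: "bij_betw f X Y" and \<phi>: "\<phi> \<in> iso (as_group X G) (as_group Y H)"
    and eq: "\<And>g x. g \<in> G \<Longrightarrow> x \<in> X \<Longrightarrow> f (g x) = \<phi> g (f x)"
    unfolding perm_isomorphic_def by blast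
  have "group (as_group X G)"
    using G subgroup.subgroup_is_group[OF _ group_BijGroup] by (auto simp: perm_group_def)
  from group.iso_set_sym[OF this \<phi>]
  have \<phi>': "inv_into G \<phi> \<in> iso (as_group Y H) (as_group X G)" by simp
  have bij: "bij_betw \<phi> G H" using \<phi> by (simp add: iso_def)
  have "inv_into X f (h y) = inv_into G \<phi> h (inv_into X f y)" if "h \<in> H" "y \<in> Y" for h y
  proof -
    define g x where "g = inv_into G \<phi> h" and "x = inv_into X f y"
    have g: "g \<in> G" "\<phi> g = h"
      using bij that(1) unfolding g_def
      by (auto simp: bij_betw_def inv_into_into f_inv_into_f)
    have x: "x \<in> X" "f x = y"
      using f that(2) unfolding x_def
      by (auto simp: bij_betw_def inv_into_into f_inv_into_f)
    have "h y = f (g x)" using eq g x by auto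
    then have "inv_into X f (h y) = g x"
      using f perm_group_maps_to[OF G g(1) x(1)] by (simp add: bij_betw_def)
    then show ?thesis by (simp add: g_def x_def)
  qed
  then show ?thesis
    unfolding perm_isomorphic_def using G H \<phi>' bij_betw_inv_into[OF f] by blast
qed

lemma perm_isomorphic_trans:
  assumes "perm_isomorphic X G Y H" "perm_isomorphic Y H Z K"
  shows "perm_isomorphic X G Z K"
proof -
  from assms(1) obtain f \<phi> where G: "perm_group X G"
    and f: "bij_betw f X Y" and \<phi>: "\<phi> \<in> iso (as_group X G) (as_group Y H)"
    and eq: "\<And>g x. g \<in> G \<Longrightarrow> x \<in> X \<Longrightarrow> f (g x) = \<phi> g (f x)"
    unfolding perm_isomorphic_def by blast
  from assms(2) obtain f' \<phi>' where K: "perm_group Z K"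
    and f': "bij_betw f' Y Z" and \<phi>': "\<phi>' \<in> iso (as_group Y H) (as_group Z K)"
    and eq': "\<And>g x. g \<in> H \<Longrightarrow> x \<in> Y \<Longrightarrow> f' (g x) = \<phi>' g (f' x)"
    unfolding perm_isomorphic_def by blast
  have "(f' \<circ> f) (g x) = (\<phi>' \<circ> \<phi>) g ((f' \<circ> f) x)" if "g \<in> G" "x \<in> X" for g x
  proof -
    have "\<phi> g \<in> H" using \<phi> that(1) by (auto simp: iso_def bij_betw_def)
    moreover have "f x \<in> Y" using f that(2) by (auto simp: bij_betw_def)
    ultimately show ?thesis using eq eq' that by simp
  qed
  then show ?thesis
    unfolding perm_isomorphic_def
    using G K bij_betw_trans[OF f f'] iso_set_trans[OF \<phi> \<phi>'] by blast
qed

lemma equiv_perm_iso_rel: "equiv {(X, G). perm_group X G} perm_iso_rel"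
proof (rule equivI)
  show "perm_iso_rel \<subseteq> {(X, G). perm_group X G} \<times> {(X, G). perm_group X G}"
    by (auto simp: perm_iso_rel_def perm_isomorphic_def)
  show "refl_on {(X, G). perm_group X G} perm_iso_rel"
    by (auto simp: refl_on_def perm_iso_rel_def perm_isomorphic_refl)
  show "sym perm_iso_rel"
    by (auto simp: sym_def perm_iso_rel_def intro: perm_isomorphic_sym)
  show "trans perm_iso_rel"
    by (auto simp: trans_def perm_iso_rel_def intro: perm_isomorphic_trans)
qed

end

theory Submission
  imports Defs "HOL-Library.Product_Plus" "HOL-Algebra.Algebraic_Closure_Type" "HOL-Library.Z2"
begin

text \<open>
  Let \<open>q\<close> be a power of 2 and let \<open>G\<close> be the automorphism group of the symplectic generalized
  quadrangle \<open>W(q)\<close>, acting on the points of \<open>PG(3,q)\<close>. It is primitive of rank 3, so \<open>\<Gamma>\<^sub>S\<close> is either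
  the collinearity graph or its complement whenever \<open>S\<close> is a \<open>G\<close>-regular section.

  If \<open>\<Gamma>\<^sub>S\<close> is the noncollinearity graph, then the parts \<open>T\<close> are lines, and a point off a line is
  collinear with exactly one point of it, so that \<open>m(S,T) = 2\<close>. This case occurs: take an elliptic
  quadric for \<open>S\<close> and a regular spread for the partition.

  If \<open>\<Gamma>\<^sub>S\<close> is the collinearity graph, then \<open>S\<close> is a line and all parts are ovoids. This case does not
  occur: an ovoid meets every hyperbolic line in 0 or 2 points, but a hyperbolic line has \<open>q + 1\<close>
  points, which is odd.
\<close>

text \<open>Because \<open>m(G)\<close> is a maximum over all pairs, every non-synchronizing
  partition has to be classified, not only the one exhibited. What makes this feasible is that
  automorphisms act transitively on collinear pairs and on noncollinear pairs: two points of
  \<open>S\<close> and two points of a part can never form pairs of the same kind, so one set is a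
  clique, the other a coclique, and a clique met by every translate of a coclique fills a whole
  line. The 0-or-2 property of ovoids comes from a double count against the polar of the hyperbolic
  line. It needs only incidence facts, so the combinatorics lives in a locale without coordinates.
  Regularity of the section costs nothing: automorphisms permute the lines, and an ovoid meets each
  line once, so any ovoid fits any spread. In coordinates, a single constant \<open>e\<close> for
  which t^2 + t + e has no root in the field yields the elliptic form, the spread and the next
  larger field.\<close>

no_notation var (\<open>X\<index>\<close>)

section \<open>Automorphisms, lines and ovoids of a relation\<close>

definition common_perp :: "'a set \<Rightarrow> ('a \<Rightarrow> 'a \<Rightarrow> bool) \<Rightarrow> 'a \<Rightarrow> 'a \<Rightarrow> 'a set" where
  "common_perp X R x y = {z \<in> X. R x z \<and> R y z}"

definition aut_group :: "'a set \<Rightarrow> ('a \<Rightarrow> 'a \<Rightarrow> bool) \<Rightarrow> ('a \<Rightarrow> 'a) set" where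
  "aut_group X R = {g \<in> Bij X. \<forall>x\<in>X. \<forall>y\<in>X. R (g x) (g y) \<longleftrightarrow> R x y}"

text \<open>A totally isotropic line is its own polar, so it can be recovered from \<open>R\<close>
  as the common perp of two of its points. Lines are thus determined by \<open>R\<close>, and
  automorphisms of \<open>R\<close> preserve them.\<close>

definition line_of :: "'a set \<Rightarrow> ('a \<Rightarrow> 'a \<Rightarrow> bool) \<Rightarrow> 'a set \<Rightarrow> bool" where
  "line_of X R L \<longleftrightarrow> (\<exists>x\<in>X. \<exists>y\<in>X. x \<noteq> y \<and> R x y \<and> L = common_perp X R x y)"

definition ovoid_of :: "'a set \<Rightarrow> ('a \<Rightarrow> 'a \<Rightarrow> bool) \<Rightarrow> 'a set \<Rightarrow> bool" where
  "ovoid_of X R U \<longleftrightarrow> U \<subseteq> X \<and> (\<forall>L. line_of X R L \<longrightarrow> card (U \<inter> L) = 1)"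

lemma aut_group_apply: "g \<in> aut_group X R \<Longrightarrow> x \<in> X \<Longrightarrow> g x \<in> X"
  using Bij_imp_funcset[of g X] by (auto simp: aut_group_def)

lemma aut_group_bij: "g \<in> aut_group X R \<Longrightarrow> bij_betw g X X"
  by (auto simp: aut_group_def Bij_def)

lemma aut_group_eq_iff:
  "g \<in> aut_group X R \<Longrightarrow> x \<in> X \<Longrightarrow> y \<in> X \<Longrightarrow> g x = g y \<longleftrightarrow> x = y"
  using aut_group_bij[of g X R] by (auto simp: bij_betw_def inj_on_def)

lemma aut_group_rel_iff:
  "g \<in> aut_group X R \<Longrightarrow> x \<in> X \<Longrightarrow> y \<in> X \<Longrightarrow> R (g x) (g y) \<longleftrightarrow> R x y"
  by (auto simp: aut_group_def)

lemma perm_group_aut_group: "perm_group X (aut_group X R)"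
  unfolding perm_group_def
proof (rule group.subgroupI[OF group_BijGroup])
  show "aut_group X R \<subseteq> carrier (BijGroup X)"
    by (auto simp: aut_group_def BijGroup_def)
  have "(\<lambda>x\<in>X. x) \<in> aut_group X R"
    by (auto simp: aut_group_def id_Bij)
  then show "aut_group X R \<noteq> {}" by blast
next
  fix g assume g: "g \<in> aut_group X R"
  then have gB: "g \<in> Bij X" by (auto simp: aut_group_def)
  have "R (inv_into X g x) (inv_into X g y) \<longleftrightarrow> R x y" if "x \<in> X" "y \<in> X" for x y
  proof -
    have "inv_into X g x \<in> X" "inv_into X g y \<in> X"
      using Bij_inv_into_mem[OF gB] that by auto
    moreover have "g (inv_into X g x) = x" "g (inv_into X g y) = y"
      using aut_group_bij[OF g] that by (auto simp: bij_betw_def f_inv_into_f)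
    ultimately show ?thesis using aut_group_rel_iff[OF g] by metis
  qed
  then show "inv\<^bsub>BijGroup X\<^esub> g \<in> aut_group X R"
    using inv_BijGroup[OF gB] restrict_inv_into_Bij[OF gB] by (auto simp: aut_group_def)
next
  fix g h assume g: "g \<in> aut_group X R" and h: "h \<in> aut_group X R"
  then have "g \<in> Bij X" "h \<in> Bij X" by (auto simp: aut_group_def)
  then show "g \<otimes>\<^bsub>BijGroup X\<^esub> h \<in> aut_group X R"
    using aut_group_rel_iff[OF g] aut_group_rel_iff[OF h] aut_group_apply[OF h]
    by (auto simp: BijGroup_def aut_group_def compose_Bij compose_eq)
qed

lemma aut_group_inverse:
  assumes g: "g \<in> aut_group X R"
  obtains h where "h \<in> aut_group X R" "\<And>x. x \<in> X \<Longrightarrow> h (g x) = x" "\<And>x. x \<in> X \<Longrightarrow> g (h x) = x"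
proof
  have gB: "g \<in> Bij X" using g by (auto simp: aut_group_def)
  have bij: "bij_betw g X X" using aut_group_bij[OF g] .
  show "(\<lambda>x\<in>X. inv_into X g x) \<in> aut_group X R"
    using subgroup.m_inv_closed[OF perm_group_aut_group[unfolded perm_group_def] g]
      inv_BijGroup[OF gB] by simp
  show "(\<lambda>x\<in>X. inv_into X g x) (g x) = x" if "x \<in> X" for x
    using bij aut_group_apply[OF g that] that by (simp add: bij_betw_inv_into_left)
  show "g ((\<lambda>x\<in>X. inv_into X g x) x) = x" if "x \<in> X" for x
    using bij that by (simp add: bij_betw_inv_into_right)
qed

lemma aut_group_image_common_perp:
  assumes g: "g \<in> aut_group X R" and "x \<in> X" "y \<in> X"
  shows "g ` common_perp X R x y = common_perp X R (g x) (g y)"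
proof (intro equalityI subsetI)
  fix z assume "z \<in> g ` common_perp X R x y"
  then show "z \<in> common_perp X R (g x) (g y)"
    using aut_group_rel_iff[OF g] aut_group_apply[OF g] assms by (auto simp: common_perp_def)
next
  fix z assume z: "z \<in> common_perp X R (g x) (g y)"
  then obtain w where w: "w \<in> X" "z = g w"
    using aut_group_bij[OF g] by (auto simp: bij_betw_def common_perp_def)
  with z show "z \<in> g ` common_perp X R x y"
    using aut_group_rel_iff[OF g] assms by (auto simp: common_perp_def)
qed

lemma aut_group_image_line:
  assumes g: "g \<in> aut_group X R" and L: "line_of X R L"
  shows "line_of X R (g ` L)"
  using L aut_group_image_common_perp[OF g] aut_group_rel_iff[OF g] aut_group_apply[OF g]
    aut_group_eq_iff[OF g]
  unfolding line_of_def by metis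

text \<open>Trades a translate of one set for the inverse translate of the other, so that regularity
  can be read either as a statement on translates of the section or on translates of the
  parts.\<close>

lemma card_image_Int_eq:
  assumes g: "g \<in> aut_group X R" and h: "\<And>x. x \<in> X \<Longrightarrow> h (g x) = x" and "A \<subseteq> X" "B \<subseteq> X"
    and h': "\<And>x. x \<in> X \<Longrightarrow> g (h x) = x"
  shows "card (g ` A \<inter> B) = card (A \<inter> h ` B)"
proof -
  have "g ` (A \<inter> h ` B) = g ` A \<inter> B"
  proof (intro equalityI subsetI)
    fix y assume "y \<in> g ` (A \<inter> h ` B)"
    then obtain b where "b \<in> B" "h b \<in> A" "y = g (h b)" by auto
    then show "y \<in> g ` A \<inter> B" using assms(4) h' by auto
  next
    fix y assume "y \<in> g ` A \<inter> B"
    then obtain a where a: "a \<in> A" "g a \<in> B" "y = g a" by auto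
    then have "a = h (g a)" using h assms(3) by auto
    then show "y \<in> g ` (A \<inter> h ` B)" using a by blast
  qed
  moreover have "inj_on g (A \<inter> h ` B)"
    using aut_group_bij[OF g] \<open>A \<subseteq> X\<close> by (auto simp: bij_betw_def inj_on_def)
  ultimately show ?thesis using card_image by metis
qed

lemma card_2_points:
  assumes "card A \<ge> 2" obtains a b where "a \<in> A" "b \<in> A" "a \<noteq> b"
proof -
  have "finite A" using assms by (intro card_ge_0_finite) simp
  then show ?thesis using that card_le_Suc0_iff_eq[of A] assms by force
qed

text \<open>
  Incidence properties of the points of \<open>PG(3,q)\<close> under a symplectic polarity \<open>R\<close>, for even \<open>q\<close>:
  \<open>common_perp X R x y\<close> is the polar of the line \<open>xy\<close>, and it is that line itself if \<open>R x y\<close>.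
\<close>

locale symplectic_quadrangle =
  fixes X :: "'a set" and R :: "'a \<Rightarrow> 'a \<Rightarrow> bool" and q :: nat
  assumes finite_X: "finite X"
    and X_nonempty: "X \<noteq> {}"
    and q_even: "even q" and q_pos: "0 < q"
    and rel_refl [simp]: "R x x"
    and rel_sym: "R x y \<Longrightarrow> R y x"
    and card_perp: "\<lbrakk>x \<in> X; y \<in> X; x \<noteq> y\<rbrakk> \<Longrightarrow> card (common_perp X R x y) = Suc q"
    and two_determine: "\<lbrakk>x \<in> X; y \<in> X; x \<noteq> y; z \<in> common_perp X R x y; z' \<in> common_perp X R x y;
        z \<noteq> z'; w \<in> X; R z w; R z' w; u \<in> common_perp X R x y\<rbrakk> \<Longrightarrow> R u w"
    and perp_meets: "\<lbrakk>x \<in> X; y \<in> X; x \<noteq> y; w \<in> X\<rbrakk> \<Longrightarrow> \<exists>z \<in> common_perp X R x y. R z w"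
    and not_universal: "x \<in> X \<Longrightarrow> \<exists>y\<in>X. \<not> R x y"
    and aut_transitive_pairs: "\<lbrakk>x \<in> X; y \<in> X; x' \<in> X; y' \<in> X; x \<noteq> y; x' \<noteq> y'; R x y \<longleftrightarrow> R x' y'\<rbrakk>
      \<Longrightarrow> \<exists>g \<in> aut_group X R. g x = x' \<and> g y = y'"
begin

abbreviation perp where "perp \<equiv> common_perp X R"
abbreviation G where "G \<equiv> aut_group X R"

section \<open>Totally isotropic and hyperbolic lines\<close>

lemma perp_iff: "z \<in> perp x y \<longleftrightarrow> z \<in> X \<and> R x z \<and> R y z"
  by (auto simp: common_perp_def)

lemma finite_perp: "finite (perp x y)"
  using finite_X by (auto simp: common_perp_def)

lemma perp_card_ge: "\<lbrakk>x \<in> X; y \<in> X; x \<noteq> y\<rbrakk> \<Longrightarrow> card (perp x y) \<ge> 3"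
  using card_perp[of x y] q_even q_pos by presburger

text \<open>Collinear \<open>x\<close> and \<open>y\<close> lie in their own common perp, so they
  can serve as the two determining points: \<open>v\<close> is perpendicular to both, hence to
  \<open>u\<close>.\<close>

lemma line_clique:
  assumes "x \<in> X" "y \<in> X" "x \<noteq> y" "R x y" "u \<in> perp x y" "v \<in> perp x y"
  shows "R u v"
proof (rule two_determine[of x y x y])
  show "x \<in> perp x y" "y \<in> perp x y" using assms rel_sym by (auto simp: perp_iff)
qed (use assms in \<open>auto simp: perp_iff\<close>)

lemma line_eq:
  assumes "x \<in> X" "y \<in> X" "x \<noteq> y" "R x y" "u \<in> perp x y" "v \<in> perp x y" "u \<noteq> v"
  shows "perp u v = perp x y"
proof (rule sym, rule card_subset_eq)
  show "finite (perp u v)" by (rule finite_perp)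
  show "perp x y \<subseteq> perp u v"
    using line_clique[OF assms(1-4)] assms(5,6) by (auto simp: perp_iff)
  show "card (perp x y) = card (perp u v)"
    using assms by (simp add: card_perp perp_iff)
qed

lemma lineE:
  assumes "line_of X R L" "u \<in> L" "v \<in> L" "u \<noteq> v"
  shows "L = perp u v" "R u v" "u \<in> X" "v \<in> X"
proof -
  from assms(1) obtain x y where xy: "x \<in> X" "y \<in> X" "x \<noteq> y" "R x y" "L = perp x y"
    by (auto simp: line_of_def)
  show "L = perp u v" using line_eq xy assms by metis
  show "R u v" using line_clique xy assms by metis
  show "u \<in> X" "v \<in> X" using xy assms by (auto simp: perp_iff)
qed

lemma line_card: "line_of X R L \<Longrightarrow> card L = Suc q"
  using card_perp by (auto simp: line_of_def)

lemma line_perp: "\<lbrakk>x \<in> X; y \<in> X; x \<noteq> y; R x y\<rbrakk> \<Longrightarrow> line_of X R (perp x y)"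
  by (auto simp: line_of_def)

lemma line_subset: "line_of X R L \<Longrightarrow> L \<subseteq> X"
  by (auto simp: line_of_def perp_iff)

text \<open>Were \<open>u\<close> and \<open>v\<close> collinear, \<open>x\<close> and
  \<open>y\<close> would both lie on the line through them and so be collinear.\<close>

lemma hyperbolic_coclique:
  assumes "x \<in> X" "y \<in> X" "\<not> R x y" "u \<in> perp x y" "v \<in> perp x y" "u \<noteq> v"
  shows "\<not> R u v"
proof
  assume "R u v"
  moreover have "u \<in> X" "v \<in> X" "x \<in> perp u v" "y \<in> perp u v"
    using assms rel_sym by (auto simp: perp_iff)
  ultimately have "R x y" using line_clique assms by blast
  with assms show False by blast
qed

lemma exists_collinear: "x \<in> X \<Longrightarrow> \<exists>y\<in>X. y \<noteq> x \<and> R x y"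
proof -
  assume x: "x \<in> X"
  then obtain b where b: "b \<in> X" "\<not> R x b" using not_universal by blast
  then have "perp x b \<noteq> {}" using perp_card_ge[of x b] x by (metis card.empty not_numeral_le_zero rel_refl)
  then obtain z where "z \<in> perp x b" by blast
  then have "z \<in> X" "R x z" "z \<noteq> x" using b rel_sym by (auto simp: perp_iff)
  then show ?thesis by blast
qed

lemma exists_line: "\<exists>L. line_of X R L"
  using X_nonempty exists_collinear by (fastforce simp: line_of_def)

lemma aut_transitive: "\<lbrakk>x \<in> X; y \<in> X\<rbrakk> \<Longrightarrow> \<exists>g \<in> G. g x = y"
  using exists_collinear aut_transitive_pairs by metis

subsection \<open>Ovoids\<close>

lemma ovoid_coclique:
  assumes U: "ovoid_of X R U" and "a \<in> U" "b \<in> U" "R a b"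
  shows "a = b"
proof (rule ccontr)
  assume ne: "a \<noteq> b"
  have ab: "a \<in> X" "b \<in> X" using assms by (auto simp: ovoid_of_def)
  then have "card (U \<inter> perp a b) = 1"
    using U line_perp ne assms by (auto simp: ovoid_of_def)
  moreover have "a \<in> U \<inter> perp a b" "b \<in> U \<inter> perp a b"
    using assms ab rel_sym by (auto simp: perp_iff)
  ultimately show False using ne by (metis card_1_singletonE singletonD)
qed

text \<open>The polar plane of \<open>w\<close> meets a projective line in one point or contains it;
  \<open>u\<close> excludes containment. For a totally isotropic line this is the generalized
  quadrangle axiom, but hyperbolic lines are covered as well.\<close>

lemma card_perp_rel_eq_1:
  assumes "x \<in> X" "y \<in> X" "x \<noteq> y" "w \<in> X" "u \<in> perp x y" "\<not> R u w"
  shows "card {z \<in> perp x y. R z w} = 1"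
proof -
  obtain z where z: "z \<in> perp x y" "R z w" using perp_meets assms by blast
  have "z' = z" if "z' \<in> perp x y" "R z' w" for z'
    using two_determine[of x y z z' w u] assms z that by blast
  then have "{z \<in> perp x y. R z w} = {z}" using z by blast
  then show ?thesis by simp
qed

text \<open>There are \<open>q + 1\<close> lines through \<open>z\<close>, and each carries exactly
  one ovoid point.\<close>

lemma ovoid_neighbours:
  assumes U: "ovoid_of X R U" and z: "z \<in> X" "z \<notin> U"
  shows "card {a \<in> U. R z a} = Suc q"
proof -
  \<comment> \<open>The hyperbolic line \<open>perp z b\<close> serves as an index set for the lines
    through \<open>z\<close>: each of them has exactly one point perpendicular to
    \<open>b\<close>.\<close>
  obtain b where b: "b \<in> X" "\<not> R z b" using not_universal z by blast
  then have zb: "z \<noteq> b" by auto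
  have UX: "U \<subseteq> X" using U by (auto simp: ovoid_of_def)
  let ?A = "{a \<in> U. R z a}" and ?B = "perp z b"
  have fin: "finite ?A" "finite ?B" using finite_X UX finite_perp by (auto intro: finite_subset)
  have "(\<Sum>a\<in>?A. card {u \<in> ?B. R a u}) = 1 * card ?B"
  proof (rule sum_multicount[OF fin], rule ballI)
    fix u assume u: "u \<in> ?B"
    then have u': "u \<in> X" "R z u" "u \<noteq> z" using b rel_sym by (auto simp: perp_iff)
    then have "card (U \<inter> perp z u) = 1" using U line_perp z by (auto simp: ovoid_of_def)
    moreover have "{a \<in> ?A. R a u} = U \<inter> perp z u"
      using UX rel_sym by (auto simp: perp_iff)
    ultimately show "card {a \<in> ?A. R a u} = 1" by simp
  qed
  moreover have "card {u \<in> ?B. R a u} = 1" if a: "a \<in> ?A" for a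
  proof -
    have a': "a \<in> X" "R z a" "z \<noteq> a" using a UX z by auto
    have "card {v \<in> perp z a. R v b} = 1"
      by (rule card_perp_rel_eq_1[of _ _ _ z]) (use z a' b rel_sym in \<open>auto simp: perp_iff\<close>)
    moreover have "{u \<in> ?B. R a u} = {v \<in> perp z a. R v b}"
      using rel_sym by (auto simp: perp_iff)
    ultimately show ?thesis by simp
  qed
  ultimately have "card ?A = card ?B" by simp
  then show ?thesis using card_perp z b zb by simp
qed

text \<open>Double count collinear pairs between the ovoid and a line \<open>L\<close>, leaving out
  their common point \<open>o1\<close>: each other ovoid point sees one point of \<open>L\<close>,
  and each of the \<open>q\<close> other points of \<open>L\<close> sees \<open>q\<close> other
  ovoid points.\<close>

lemma ovoid_card:
  assumes U: "ovoid_of X R U"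
  shows "card U = Suc (q * q)"
proof -
  obtain L where L: "line_of X R L" using exists_line by blast
  have LX: "L \<subseteq> X" and UX: "U \<subseteq> X" using L U by (auto simp: line_of_def ovoid_of_def perp_iff)
  have "card (U \<inter> L) = 1" using U L by (auto simp: ovoid_of_def)
  then obtain o1 where o1: "U \<inter> L = {o1}" by (metis card_1_singletonE)
  let ?A = "U - {o1}" and ?B = "L - {o1}"
  have fin: "finite ?A" "finite ?B" using finite_X LX UX by (auto intro: finite_subset)
  have "(\<Sum>a\<in>?A. card {z \<in> ?B. R a z}) = q * card ?B"
  proof (rule sum_multicount[OF fin], rule ballI)
    fix z assume z: "z \<in> ?B"
    then have "z \<in> X" "z \<notin> U" using LX o1 by auto
    then have "card {a \<in> U. R z a} = Suc q" by (rule ovoid_neighbours[OF U])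
    moreover have "{a \<in> ?A. R a z} = {a \<in> U. R z a} - {o1}"
      using rel_sym by auto
    moreover have "o1 \<in> {a \<in> U. R z a}"
      using lineE(2)[OF L, of z o1] z o1 by auto
    ultimately show "card {a \<in> ?A. R a z} = q" by simp
  qed
  moreover have "card {z \<in> ?B. R a z} = 1" if a: "a \<in> ?A" for a
  proof -
    have na: "\<not> R o1 a" using ovoid_coclique[OF U, of o1 a] a o1 by auto
    obtain x y where xy: "x \<in> X" "y \<in> X" "x \<noteq> y" "L = perp x y" using L by (auto simp: line_of_def)
    have "card {z \<in> perp x y. R z a} = 1"
      by (rule card_perp_rel_eq_1[of _ _ _ o1]) (use xy o1 na UX a in auto)
    moreover have "{z \<in> ?B. R a z} = {z \<in> perp x y. R z a}"
      using xy na rel_sym by auto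
    ultimately show ?thesis by simp
  qed
  ultimately have "card ?A = q * card ?B" by simp
  moreover have "o1 \<in> U" "o1 \<in> L" using o1 by auto
  moreover have "finite U" "finite L" using finite_X LX UX by (auto intro: finite_subset)
  ultimately show ?thesis using line_card[OF L] card_Suc_Diff1[of U o1] by simp
qed

text \<open>If the hyperbolic line meets \<open>U\<close>, then its polar line misses
  \<open>U\<close>, and counting perpendicular pairs between \<open>U\<close> and the polar line
  forces exactly 2 common points.\<close>

lemma ovoid_hyperbolic_even:
  assumes U: "ovoid_of X R U" and xy: "x \<in> X" "y \<in> X" "\<not> R x y"
  shows "even (card (U \<inter> perp x y))"
proof (cases "U \<inter> perp x y = {}")
  case False
  let ?H = "perp x y"
  have xy_ne: "x \<noteq> y" using xy by auto
  have UX: "U \<subseteq> X" using U by (auto simp: ovoid_of_def)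
  have finU: "finite U" using finite_X UX by (auto intro: finite_subset)
  obtain a where a: "a \<in> U" "a \<in> ?H" using False by blast
  obtain z z' where z: "z \<in> ?H" "z' \<in> ?H" "z \<noteq> z'"
    using card_2_points perp_card_ge[OF xy(1,2) xy_ne] by (metis numeral_2_eq_2 numeral_3_eq_3 Suc_leD)
  \<comment> \<open>The polar of \<open>?H\<close>, which is the hyperbolic line through
    \<open>x\<close> and \<open>y\<close>; every point of \<open>?K\<close> is perpendicular to
    every point of \<open>?H\<close>.\<close>
  let ?K = "perp z z'"
  have zX: "z \<in> X" "z' \<in> X" using z by (auto simp: perp_iff)
  have xK: "x \<in> ?K" "y \<in> ?K" using xy z rel_sym by (auto simp: perp_iff)
  have HK: "R u w" if "u \<in> ?K" "w \<in> ?H" for u w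
    using two_determine[of z z' x y w u] zX z(3) xK xy_ne that by (auto simp: perp_iff)
  have "(\<Sum>w\<in>U. card {u \<in> ?K. R w u}) = Suc q * card ?K"
  proof (rule sum_multicount[OF finU finite_perp], rule ballI)
    fix u assume u: "u \<in> ?K"
    \<comment> \<open>A point of \<open>U\<close> on \<open>?K\<close> is perpendicular to
      \<open>a\<close> and so equals \<open>a\<close>. But then \<open>a\<close> would be
      perpendicular to the two points \<open>z\<close> and \<open>z'\<close> of its own hyperbolic
      line, at least one of which differs from it.\<close>
    have "u \<notin> U"
    proof
      assume "u \<in> U"
      then have "u = a" using ovoid_coclique[OF U] HK[OF u a(2)] a by blast
      then have "R a z" "R a z'" using u rel_sym by (auto simp: perp_iff)
      then show False using hyperbolic_coclique[OF xy a(2)] z by metis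
    qed
    then have "card {w \<in> U. R u w} = Suc q"
      using ovoid_neighbours[OF U] u by (auto simp: perp_iff)
    moreover have "{w \<in> U. R u w} = {w \<in> U. R w u}" using rel_sym by auto
    ultimately show "card {w \<in> U. R w u} = Suc q" by simp
  qed
  moreover have "card ?K = Suc q" using card_perp zX z by simp
  moreover have "(\<Sum>w\<in>U. card {u \<in> ?K. R w u})
      = (\<Sum>w\<in>U \<inter> ?H. card {u \<in> ?K. R w u}) + (\<Sum>w\<in>U - ?H. card {u \<in> ?K. R w u})"
    by (rule sum.Int_Diff[OF finU])
  moreover have "(\<Sum>w\<in>U \<inter> ?H. card {u \<in> ?K. R w u}) = (\<Sum>w\<in>U \<inter> ?H. Suc q)"
  proof (rule sum.cong[OF refl])
    fix w assume "w \<in> U \<inter> ?H"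
    then have "{u \<in> ?K. R w u} = ?K" using HK rel_sym by auto
    then show "card {u \<in> ?K. R w u} = Suc q" using card_perp zX z by simp
  qed
  moreover have "(\<Sum>w\<in>U - ?H. card {u \<in> ?K. R w u}) = (\<Sum>w\<in>U - ?H. 1)"
  proof (rule sum.cong[OF refl])
    fix w assume w: "w \<in> U - ?H"
    then obtain u where u: "u \<in> {x, y}" "\<not> R u w" using UX by (auto simp: perp_iff)
    have "card {z \<in> ?K. R z w} = 1"
      by (rule card_perp_rel_eq_1[of _ _ _ u]) (use zX z w u xK UX in auto)
    moreover have "{u \<in> ?K. R w u} = {z \<in> ?K. R z w}" using rel_sym by auto
    ultimately show "card {u \<in> ?K. R w u} = 1" by simp
  qed
  moreover have "card U = card (U \<inter> ?H) + card (U - ?H)"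
    by (simp add: card_Diff_subset_Int finU card_mono)
  \<comment> \<open>With h common points, those contribute h(q + 1) pairs and the other q^2 + 1 - h
    ovoid points one pair each, against (q + 1)^2 from the side of \<open>?K\<close>; hence hq =
    2q.\<close>
  ultimately have "card (U \<inter> ?H) * q + Suc (q * q) = Suc q * Suc q"
    using ovoid_card[OF U] by (simp add: algebra_simps)
  then have "card (U \<inter> ?H) * q = 2 * q" by simp
  then show ?thesis using q_pos by simp
qed simp

lemma no_ovoid_partition:
  assumes P: "partition_on X P" and ov: "\<And>T. T \<in> P \<Longrightarrow> ovoid_of X R T"
  shows False
proof -
  obtain x y where xy: "x \<in> X" "y \<in> X" "\<not> R x y" using X_nonempty not_universal by blast
  let ?H = "perp x y"
  have HX: "?H \<subseteq> X" by (auto simp: perp_iff)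
  have finP: "finite P" using P finite_X by (metis finite_UnionD partition_onD1)
  have "?H = (\<Union>T\<in>P. T \<inter> ?H)" using P HX by (auto simp: partition_on_def)
  moreover have "card (\<Union>T\<in>P. T \<inter> ?H) = (\<Sum>T\<in>P. card (T \<inter> ?H))"
  proof (rule card_UN_disjoint[OF finP])
    show "\<forall>T\<in>P. \<forall>T'\<in>P. T \<noteq> T' \<longrightarrow> T \<inter> ?H \<inter> (T' \<inter> ?H) = {}"
      using P by (auto simp: partition_on_def disjoint_def)
  qed (use finite_perp in auto)
  ultimately have "even (card ?H)"
    using ovoid_hyperbolic_even[OF ov xy] by (metis (no_types, lifting) dvd_sum)
  moreover have "card ?H = Suc q" using card_perp xy by force
  ultimately show False using q_even by simp
qed

end

context symplectic_quadrangle
begin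

subsection \<open>Primitivity\<close>

lemma transitive_action_G: "transitive_action (as_group X G) X (\<lambda>g. g)"
proof -
  have "subgroup G (BijGroup X)"
    using perm_group_aut_group by (simp add: perm_group_def)
  moreover have "(\<lambda>g. g) \<in> hom (as_group X G) (BijGroup X)"
    by (auto simp: hom_def BijGroup_def aut_group_def)
  ultimately have "group_hom (as_group X G) (BijGroup X) (\<lambda>g. g)"
    by (intro group_hom.intro group_hom_axioms.intro group_BijGroup
        subgroup.subgroup_is_group[OF _ group_BijGroup])
  then show ?thesis
    using aut_transitive
    by (auto simp: transitive_action_def group_action_def transitive_action_axioms_def)
qed

lemma third_point_on_line:
  assumes "a \<in> X" "b \<in> X" "a \<noteq> b"
  shows "\<exists>u \<in> perp a b. u \<noteq> a \<and> u \<noteq> b"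
proof (rule ccontr)
  assume "\<not> ?thesis"
  then have "perp a b \<subseteq> {a, b}" by blast
  then have "card (perp a b) \<le> card {a, b}" by (intro card_mono) auto
  then show False using perp_card_ge[OF assms] assms(3) by simp
qed

text \<open>A block system that identifies one pair identifies all pairs of the same kind, so
  primitivity reduces to connectedness of the collinearity graph and of its complement.\<close>

lemma primitive_G: "primitive_perm_group X G"
  unfolding primitive_perm_group_def
proof (intro conjI allI impI perm_group_aut_group transitive_action_G)
  fix P assume "partition_on X P \<and> (\<forall>g\<in>G. \<forall>T\<in>P. g ` T \<in> P)"
  then have P: "partition_on X P" and inv: "\<And>g T. g \<in> G \<Longrightarrow> T \<in> P \<Longrightarrow> g ` T \<in> P"
    by auto
  define E where "E = (\<lambda>x y. \<exists>T\<in>P. x \<in> T \<and> y \<in> T)"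
  have part: "\<And>T T'. T \<in> P \<Longrightarrow> T' \<in> P \<Longrightarrow> T \<inter> T' \<noteq> {} \<Longrightarrow> T = T'" "\<Union>P = X" "{} \<notin> P"
    using P by (auto simp: partition_on_def disjoint_def)
  have E_trans: "E x z" if "E x y" "E y z" for x y z
    using that part(1) unfolding E_def by blast
  have E_sym: "E y x" if "E x y" for x y using that by (auto simp: E_def)
  have E_refl: "E x x" if "x \<in> X" for x using that part(2) by (auto simp: E_def)
  have E_X: "x \<in> X" "y \<in> X" if "E x y" for x y using that part(2) by (auto simp: E_def)
  have E_move: "E x' y'"
    if xy: "E x y" "x \<noteq> y" and xy': "x' \<in> X" "y' \<in> X" "x' \<noteq> y'" "R x y \<longleftrightarrow> R x' y'" for x y x' y'
  proof -
    obtain g where "g \<in> G" "g x = x'" "g y = y'"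
      using aut_transitive_pairs[of x y x' y'] E_X[OF xy(1)] xy xy' by blast
    moreover obtain T where "T \<in> P" "x \<in> T" "y \<in> T" using xy(1) by (auto simp: E_def)
    ultimately show ?thesis using inv by (auto simp: E_def)
  qed
  have all: "P = {X}" if E_all: "\<And>x y. x \<in> X \<Longrightarrow> y \<in> X \<Longrightarrow> E x y"
  proof -
    have "T = X" if T: "T \<in> P" for T
    proof -
      obtain x where x: "x \<in> T" using part(3) T by fastforce
      then have "x \<in> X" using T part(2) by auto
      have "y \<in> T" if y: "y \<in> X" for y
      proof -
        obtain T' where "T' \<in> P" "x \<in> T'" "y \<in> T'"
          using E_all[OF \<open>x \<in> X\<close> y] by (auto simp: E_def)
        then show ?thesis using part(1)[OF T] x by blast
      qed
      then show ?thesis using T part(2) by auto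
    qed
    moreover have "P \<noteq> {}" using part(2) X_nonempty by auto
    ultimately show ?thesis by blast
  qed
  show "P = {X} \<or> P = (\<lambda>x. {x}) ` X"
  proof (cases "\<exists>x y. E x y \<and> x \<noteq> y")
    case False
    have "\<exists>x\<in>X. T = {x}" if T: "T \<in> P" for T
    proof -
      obtain x where x: "x \<in> T" using part(3) T by fastforce
      then have "T = {x}" using False T by (auto simp: E_def)
      then show ?thesis using T part(2) by auto
    qed
    moreover have "{x} \<in> P" if "x \<in> X" for x
    proof -
      obtain T where T: "T \<in> P" "x \<in> T" using part(2) \<open>x \<in> X\<close> by blast
      then have "T = {x}" using False by (auto simp: E_def)
      then show ?thesis using T by simp
    qed
    ultimately show ?thesis by blast
  next
    case True
    then obtain x y where xy: "E x y" "x \<noteq> y" by blast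
    have "E a b" if ab: "a \<in> X" "b \<in> X" "a \<noteq> b" for a b
    proof (cases "R a b \<longleftrightarrow> R x y")
      case True
      then show ?thesis using E_move xy ab by blast
    next
      case False
      show ?thesis
      proof (cases "R x y")
        case True
        then have nab: "\<not> R a b" using False by blast
        obtain z where z: "z \<in> perp a b" using third_point_on_line[OF ab] by blast
        then have "z \<in> X" "R a z" "R b z" "z \<noteq> a" "z \<noteq> b" using nab rel_sym by (auto simp: perp_iff)
        then have "E a z" "E b z" using E_move[OF xy] True ab by auto
        then show ?thesis using E_trans E_sym by blast
      next
        case nxy: False
        then have Rab: "R a b" using False by blast
        have noncol: "E c d" if "c \<in> X" "d \<in> X" "\<not> R c d" for c d
          using E_move[OF xy, of c d] nxy that by fastforce
        obtain u where u: "u \<in> perp a b" "u \<noteq> a" "u \<noteq> b" using third_point_on_line[OF ab] by blast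
        have a_in: "a \<in> perp a b" "b \<in> perp a b" using ab Rab rel_sym by (auto simp: perp_iff)
        have uX: "u \<in> X" using u by (simp add: perp_iff)
        \<comment> \<open>A point \<open>w\<close> not perpendicular to \<open>c\<close> cannot be
          perpendicular to both other points \<open>d\<close> and \<open>u\<close> of the line, so
          it links \<open>c\<close> to one of them. Applied from both ends, this joins
          \<open>a\<close> to \<open>b\<close>, directly or through \<open>u\<close>.\<close>
        have join: "E c d \<or> E c u"
          if cd: "c \<in> X" "d \<in> X" "{c, d} = {a, b}" for c d
        proof -
          obtain w where w: "w \<in> X" "\<not> R c w" using not_universal cd by blast
          have "\<not> (R d w \<and> R u w)"
            using two_determine[OF ab, of d u w c] w a_in u cd by (auto simp: doubleton_eq_iff)
          then show ?thesis
            using noncol[of c w] noncol[of d w] noncol[of u w] w cd uX E_trans E_sym by blast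
        qed
        show ?thesis using join[of a b] join[of b a] ab E_trans E_sym by blast
      qed
    qed
    then have "E a b" if "a \<in> X" "b \<in> X" for a b using that E_refl by metis
    then show ?thesis using all by blast
  qed
qed

subsection \<open>Non-synchronizing partitions\<close>

lemma section_graph_iff:
  "(x, y) \<in> section_graph X G S \<longleftrightarrow>
    x \<in> X \<and> y \<in> X \<and> x \<noteq> y \<and> (\<exists>g\<in>G. g x \<in> S \<and> g y \<in> S)"
  by (auto simp: section_graph_def)

lemma nonsync_via_meets:
  assumes via: "nonsync_partition_via X G S P" and T: "T \<in> P" and g: "g \<in> G"
  shows "card (g ` S \<inter> T) = 1" "card (S \<inter> g ` T) = 1"
proof -
  have meets: "card (h ` S \<inter> T) = 1" if "h \<in> G" for h
    using via T that by (auto simp: nonsync_partition_via_def regular_section_def)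
  then show "card (g ` S \<inter> T) = 1" using g .
  obtain h where h: "h \<in> G" "\<And>x. x \<in> X \<Longrightarrow> h (g x) = x" "\<And>x. x \<in> X \<Longrightarrow> g (h x) = x"
    using aut_group_inverse[OF g] by blast
  have "S \<subseteq> X" "T \<subseteq> X"
    using via T by (auto simp: nonsync_partition_via_def regular_section_def partition_on_def)
  then have "card (h ` S \<inter> T) = card (S \<inter> g ` T)"
    using card_image_Int_eq[OF h(1), of g S T] h by auto
  then show "card (S \<inter> g ` T) = 1" using meets[OF h(1)] by simp
qed

lemma card_1_unique: "card A = 1 \<Longrightarrow> a \<in> A \<Longrightarrow> b \<in> A \<Longrightarrow> a = b"
  by (metis card_1_singletonE singletonD)

text \<open>If a point \<open>p\<close> of the line were missing from \<open>A\<close>, move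
  \<open>B\<close> so that it contains \<open>p\<close>. The translate is still a coclique and meets
  \<open>A\<close> in a point of the same line, which is collinear with \<open>p\<close> and must
  therefore be \<open>p\<close>. This is used both for a section against a part and for a part
  against a section.\<close>

lemma line_of_full_clique:
  assumes A: "A \<subseteq> X" "a \<in> A" "b \<in> A" "a \<noteq> b"
    and clique: "\<And>x y. x \<in> A \<Longrightarrow> y \<in> A \<Longrightarrow> R x y"
    and B: "B \<subseteq> X" "B \<noteq> {}"
    and coclique: "\<And>x y. x \<in> B \<Longrightarrow> y \<in> B \<Longrightarrow> R x y \<Longrightarrow> x = y"
    and meets: "\<And>g. g \<in> G \<Longrightarrow> card (A \<inter> g ` B) = 1"
  shows "A = perp a b"
proof
  have ab: "a \<in> X" "b \<in> X" "R a b" using A clique by auto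
  show sub: "A \<subseteq> perp a b" using A clique by (auto simp: perp_iff)
  show "perp a b \<subseteq> A"
  proof (rule ccontr)
    assume "\<not> perp a b \<subseteq> A"
    then obtain p where p: "p \<in> perp a b" "p \<notin> A" by blast
    obtain t where t: "t \<in> B" using B by blast
    obtain g where g: "g \<in> G" "g t = p" using aut_transitive[of t p] t p B by (auto simp: perp_iff)
    obtain s where s: "s \<in> A" "s \<in> g ` B" using meets[OF g(1)] by (metis Int_iff card_1_singletonE singletonI)
    then obtain t' where t': "t' \<in> B" "s = g t'" by blast
    have "R p s" using line_clique[OF ab(1,2) A(4) ab(3) p(1)] sub s by blast
    then have "R t t'" using aut_group_rel_iff[OF g(1)] t t' g B by blast
    then have "s = p" using coclique t t' g by blast
    then show False using s p by blast
  qed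
qed

lemma nonsync_via_structure:
  assumes via: "nonsync_partition_via X G S P" and T: "T \<in> P"
  shows "line_of X R T" "section_graph X G S = {(x, y). x \<in> X \<and> y \<in> X \<and> \<not> R x y}"
proof -
  have P: "partition_on X P" and SX: "S \<subseteq> X" and S1: "1 < card S" and SX': "card S < card X"
    using via by (auto simp: nonsync_partition_via_def regular_section_def)
  have PX: "T \<subseteq> X" "T \<noteq> {}" if "T \<in> P" for T using P that by (auto simp: partition_on_def)
  have meets: "card (g ` S \<inter> T) = 1" "card (S \<inter> g ` T) = 1" if "T \<in> P" "g \<in> G" for g T
    using nonsync_via_meets[OF via] that by auto
  \<comment> \<open>An automorphism matching the two pairs would put two points into the
    intersection of a part with a translate of \<open>S\<close>.\<close>
  have apart: False
    if asm: "T \<in> P" "x \<in> T" "y \<in> T" "x \<noteq> y" "s \<in> S" "t \<in> S" "s \<noteq> t" "R s t \<longleftrightarrow> R x y"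
for x y s t T
  proof -
    have "x \<in> X" "y \<in> X" "s \<in> X" "t \<in> X" using asm SX PX by auto
    then obtain g where g: "g \<in> G" "g s = x" "g t = y"
      using aut_transitive_pairs[of s t x y] asm by blast
    then have "x \<in> g ` S \<inter> T" "y \<in> g ` S \<inter> T" using asm by auto
    then show False using card_1_unique[OF meets(1)[OF asm(1) g(1)]] asm by blast
  qed
  \<comment> \<open>A one-point part would be missed by some translate of \<open>S\<close>: move a
    point outside \<open>S\<close> onto it.\<close>
  have two: "\<exists>x\<in>T. \<exists>y\<in>T. x \<noteq> y" if T: "T \<in> P" for T
  proof (rule ccontr)
    assume no: "\<not> ?thesis"
    obtain t where t: "t \<in> T" using PX T by blast
    obtain s where s: "s \<in> X" "s \<notin> S" using SX' SX by (metis less_irrefl subsetI subset_antisym)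
    obtain g where g: "g \<in> G" "g s = t" using aut_transitive[of s t] s t PX T by blast
    obtain x where "x \<in> g ` S \<inter> T" using meets(1)[OF T g(1)] by (metis card_1_singletonE singletonI)
    then obtain s' where "s' \<in> S" "g s' = t" using no t by blast
    then show False using aut_group_eq_iff[OF g(1), of s s'] s g SX by auto
  qed
  obtain s1 s2 where s12: "s1 \<in> S" "s2 \<in> S" "s1 \<noteq> s2"
    using card_2_points[of S] S1 by auto
  have S_coclique: "s = t" if st: "s \<in> S" "t \<in> S" "R s t" for s t
  proof (rule ccontr)
    assume ne: "s \<noteq> t"
    \<comment> \<open>One collinear pair in \<open>S\<close> makes all parts cocliques; a
      noncollinear pair in a part then makes \<open>S\<close> a clique, hence a line. Its translates
      are all the lines, so regularity says that the parts are ovoids.\<close>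
    have ovoid: "ovoid_of X R T'" if T': "T' \<in> P" for T'
    proof -
      have co: "x = y" if "x \<in> T'" "y \<in> T'" "R x y" for x y
        using apart[OF T' that(1,2) _ st(1,2) ne] st that by blast
      obtain x y where xy: "x \<in> T'" "y \<in> T'" "x \<noteq> y" using two T' by blast
      have cl: "R s' t'" if "s' \<in> S" "t' \<in> S" for s' t'
        using apart[OF T' xy, of s' t'] co[OF xy(1,2)] xy that by fastforce
      have S: "S = perp s t"
        by (rule line_of_full_clique[OF SX st(1,2) ne cl PX[OF T'] co meets(2)[OF T']]) auto
      have "card (T' \<inter> L) = 1" if L: "line_of X R L" for L
      proof -
        obtain a b where ab: "a \<in> X" "b \<in> X" "a \<noteq> b" "R a b" "L = perp a b"
          using L by (auto simp: line_of_def)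
        obtain g where g: "g \<in> G" "g s = a" "g t = b"
          using aut_transitive_pairs[of s t a b] st ne SX ab by blast
        then have "g ` S = L" using S aut_group_image_common_perp[OF g(1), of s t] st SX ab by auto
        then show ?thesis using meets(1)[OF T' g(1)] by (simp add: Int_commute)
      qed
      then show ?thesis using PX[OF T'] by (simp add: ovoid_of_def)
    qed
    then show False using no_ovoid_partition[OF P] by blast
  qed
  have S12: "\<not> R s1 s2" using S_coclique s12 by blast
  have T_clique: "R x y" if "x \<in> T" "y \<in> T" for x y
    using apart[OF T that _ s12] S12 by fastforce
  obtain x y where xy: "x \<in> T" "y \<in> T" "x \<noteq> y" using two T by blast
  have "T = perp x y"
  proof (rule line_of_full_clique[OF PX(1)[OF T] xy T_clique SX])
    show "S \<noteq> {}" using s12 by blast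
    show "card (T \<inter> g ` S) = 1" if "g \<in> G" for g
      using meets(1)[OF T that] by (simp add: Int_commute)
  qed (use S_coclique in auto)
  then show "line_of X R T" using line_perp xy T_clique PX[OF T] by blast
  have "R x y \<Longrightarrow> (x, y) \<notin> section_graph X G S" for x y
    using S_coclique SX aut_group_rel_iff aut_group_eq_iff unfolding section_graph_iff by metis
  moreover have "(x, y) \<in> section_graph X G S" if xy: "x \<in> X" "y \<in> X" "\<not> R x y" for x y
  proof -
    have ne: "x \<noteq> y" using xy by auto
    then obtain g where "g \<in> G" "g x = s1" "g y = s2"
      using aut_transitive_pairs[of x y s1 s2] xy s12 S12 SX by blast
    then show ?thesis using xy s12 ne by (auto simp: section_graph_iff)
  qed
  moreover have "section_graph X G S \<subseteq> X \<times> X" by (auto simp: section_graph_iff)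
  ultimately show "section_graph X G S = {(x, y). x \<in> X \<and> y \<in> X \<and> \<not> R x y}"
    by blast
qed

lemma pair_parameter_eq_2:
  assumes via: "nonsync_partition_via X G S P" and T: "T \<in> P"
  shows "pair_parameter X G S T = 2"
proof -
  have L: "line_of X R T" using nonsync_via_structure[OF via T] by blast
  have nbhd: "closed_nbhd (graph_complement X (section_graph X G S)) x = {y \<in> X. R x y}"
    if "x \<in> X" for x
    unfolding nonsync_via_structure(2)[OF via T]
    using that by (auto simp: closed_nbhd_def graph_complement_def)
  have TX: "T \<subseteq> X" using line_subset[OF L] .
  obtain x y where xy: "x \<in> T" "y \<in> T" "x \<noteq> y"
    using card_2_points[of T] line_card[OF L] q_pos by (metis Suc_1 Suc_le_mono Suc_leI One_nat_def)
  \<comment> \<open>Aim: noncollinear \<open>z\<close> and \<open>z'\<close> that are both collinear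
    with \<open>x\<close>. They lie in every intersection taken over no point or over
    \<open>x\<close> alone but not both on the line \<open>T\<close>, which rules out the values 0
    and 1.\<close>
  obtain b where b: "b \<in> X" "\<not> R x b" using not_universal xy TX by blast
  obtain z z' where z: "z \<in> perp x b" "z' \<in> perp x b" "z \<noteq> z'"
    using card_2_points[of "perp x b"] perp_card_ge[of x b] b xy TX
    by (metis Suc_leD numeral_2_eq_2 numeral_3_eq_3 rel_refl subsetD)
  have nz: "\<not> R z z'" using hyperbolic_coclique[of x b z z'] z b xy TX by blast
  show ?thesis
    unfolding pair_parameter_def
  proof (rule Least_equality)
    show "\<forall>A. A \<subseteq> T \<and> card A = 2 \<longrightarrow>
      X \<inter> (\<Inter>x\<in>A. closed_nbhd (graph_complement X (section_graph X G S)) x) = T"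
    proof (intro allI impI, elim conjE)
      fix A assume A: "A \<subseteq> T" "card A = 2"
      then obtain u v where uv: "A = {u, v}" "u \<noteq> v" by (auto simp: card_2_iff)
      then have "u \<in> X" "v \<in> X" "T = perp u v" using lineE[OF L, of u v] A by auto
      then show "X \<inter> (\<Inter>x\<in>A. closed_nbhd (graph_complement X (section_graph X G S)) x) = T"
        using uv nbhd by (auto simp: perp_iff)
    qed
  next
    fix m assume m: "\<forall>A. A \<subseteq> T \<and> card A = m \<longrightarrow>
      X \<inter> (\<Inter>x\<in>A. closed_nbhd (graph_complement X (section_graph X G S)) x) = T"
    have "R z z'" if "m \<in> {0, 1}"
    proof -
      have "z \<in> X" "z' \<in> X" "R x z" "R x z'" using z by (auto simp: perp_iff)
      moreover have "X = T \<or> {y \<in> X. R x y} = T"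
      proof (cases "m = 0")
        case True
        then show ?thesis using m[rule_format, of "{}"] by simp
      next
        case False
        then have "X \<inter> closed_nbhd (graph_complement X (section_graph X G S)) x = T"
          using m[rule_format, of "{x}"] that xy by simp
        then show ?thesis using nbhd[of x] xy TX by auto
      qed
      ultimately have "z \<in> T" "z' \<in> T" by auto
      then show ?thesis using lineE(2)[OF L] z by blast
    qed
    then show "2 \<le> m" using nz by (cases "m = 0"; cases "m = 1") auto
  qed
qed

lemma nonsync_via_spread:
  assumes U: "ovoid_of X R U" and P: "partition_on X P" and lines: "\<And>T. T \<in> P \<Longrightarrow> line_of X R T"
  shows "nonsync_partition_via X G U P"
  unfolding nonsync_partition_via_def regular_section_def
proof (intro conjI ballI P)
  show UX: "U \<subseteq> X" using U by (simp add: ovoid_of_def)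
  fix g T assume g: "g \<in> G" and T: "T \<in> P"
  obtain h where h: "h \<in> G" "\<And>x. x \<in> X \<Longrightarrow> h (g x) = x" "\<And>x. x \<in> X \<Longrightarrow> g (h x) = x"
    using aut_group_inverse[OF g] by blast
  have "card (g ` U \<inter> T) = card (U \<inter> h ` T)"
    using card_image_Int_eq[OF g, of h U T] h UX line_subset[OF lines[OF T]] by auto
  also have "\<dots> = 1"
    using U aut_group_image_line[OF h(1) lines[OF T]] by (simp add: ovoid_of_def)
  finally show "card (g ` U \<inter> T) = 1" .
next
  show "1 < card U" using ovoid_card[OF U] q_pos by simp
  have UX: "U \<subseteq> X" using U by (simp add: ovoid_of_def)
  obtain L where L: "line_of X R L" using exists_line by blast
  have "U \<noteq> X"
  proof
    assume "U = X"
    then have "card L = 1" using U L line_subset[OF L] by (metis Int_absorb1 ovoid_of_def)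
    then show False using line_card[OF L] q_pos by simp
  qed
  then show "card U < card X" using UX finite_X by (intro psubset_card_mono) auto
qed

theorem parameter_2:
  assumes "ovoid_of X R U" "partition_on X P" "\<And>T. T \<in> P \<Longrightarrow> line_of X R T"
  shows "non_synchronizing X G" "group_parameter X G = 2"
proof -
  have via: "nonsync_partition_via X G U P" using nonsync_via_spread assms by blast
  then show "non_synchronizing X G"
    by (auto simp: non_synchronizing_def nonsync_partition_def)
  have "P \<noteq> {}" using assms(2) X_nonempty by (auto simp: partition_on_def)
  then obtain T where "T \<in> P" by blast
  then have "{pair_parameter X G S T | S T. \<exists>P. nonsync_partition_via X G S P \<and> T \<in> P} = {2}"
    using via pair_parameter_eq_2 by (auto intro!: exI)
  then show "group_parameter X G = 2" by (simp add: group_parameter_def)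
qed

end

subsection \<open>Symplectic 4-space in characteristic 2\<close>

type_synonym 'k vec4 = "'k \<times> 'k \<times> 'k \<times> 'k"

fun smult4 :: "'k::field \<Rightarrow> 'k vec4 \<Rightarrow> 'k vec4"  (infixr \<open>*v\<close> 75) where
  "k *v (a, b, c, d) = (k * a, k * b, k * c, k * d)"

text \<open>The sum of two standard hyperbolic planes, written without signs; in characteristic 2 it
  is alternating.\<close>

fun sform :: "'k::field vec4 \<Rightarrow> 'k vec4 \<Rightarrow> 'k" where
  "sform (a, b, c, d) (a', b', c', d') = a * b' + b * a' + c * d' + d * c'"

lemma sform_add_left: "sform (x + y) z = sform x z + sform y z"
  by (cases x; cases y; cases z) (simp add: algebra_simps)

lemma sform_smult_left: "sform (k *v x) z = k * sform x z"
  by (cases x; cases z) (simp add: algebra_simps)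

lemma sform_commute: "sform x y = sform y x"
  by (cases x; cases y) (simp add: algebra_simps)

lemma sform_add_right: "sform z (x + y) = sform z x + sform z y"
  by (metis sform_add_left sform_commute)

lemma sform_smult_right: "sform z (k *v x) = k * sform z x"
  by (metis sform_smult_left sform_commute)

lemmas sform_linear = sform_add_left sform_add_right sform_smult_left sform_smult_right

lemma sform_zero [simp]: "sform 0 x = 0" "sform x 0 = 0"
  by (cases x; simp add: zero_prod_def)+

lemma smult4_simps [simp]: "1 *v x = x" "0 *v x = 0" "k *v 0 = (0::'k::field vec4)"
  by (cases x; simp add: zero_prod_def)+

lemma smult4_smult4: "k *v l *v x = (k * l) *v x"
  by (cases x) simp

lemma smult4_add_right: "k *v (x + y) = k *v x + k *v y"
  by (cases x; cases y) (simp add: algebra_simps)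

lemma smult4_add_left: "(k + l) *v x = k *v x + l *v x"
  by (cases x) (simp add: algebra_simps)

lemma smult4_eq_0: "k *v x = 0 \<longleftrightarrow> k = 0 \<or> x = (0::'k::field vec4)"
  by (cases x) (auto simp: zero_prod_def)

text \<open>Subfields are subsets of one ambient field, so that fields of unbounded order share a
  type. Closure under negation comes from characteristic 2, under inverses from finiteness.\<close>

locale even_finite_field =
  fixes F :: "'k::field set"
  assumes finite_F: "finite F" and zero_F [simp]: "0 \<in> F" and one_F [simp]: "1 \<in> F"
    and add_F [simp]: "a \<in> F \<Longrightarrow> b \<in> F \<Longrightarrow> a + b \<in> F"
    and mult_F [simp]: "a \<in> F \<Longrightarrow> b \<in> F \<Longrightarrow> a * b \<in> F"
    and char_2: "(1::'k) + 1 = 0"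
    and card_even: "even (card F)"
begin

abbreviation "q \<equiv> card F"

lemma add_self [simp]: "(a::'k) + a = 0"
  using char_2 by (metis distrib_left mult.right_neutral mult_zero_right)

lemma add_self_left [simp]: "(a::'k) + (a + b) = b"
  by (simp add: add.assoc[symmetric])

lemma add_eq_0 [simp]: "(a::'k) + b = 0 \<longleftrightarrow> a = b"
  by (metis add_self add_left_cancel)

lemma vadd_self [simp]: "(x::'k vec4) + x = 0"
  by (cases x) (simp add: zero_prod_def)

lemma vadd_self_left [simp]: "(x::'k vec4) + (x + y) = y"
  by (simp add: add.assoc[symmetric])

lemma vadd_eq_0 [simp]: "(x::'k vec4) + y = 0 \<longleftrightarrow> x = y"
  by (metis vadd_self add_left_cancel)

lemma sform_self [simp]: "sform x (x::'k vec4) = 0"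
  by (cases x) (simp add: mult.commute)

lemma inverse_F [simp]: "a \<in> F \<Longrightarrow> inverse a \<in> F"
proof (cases "a = 0")
  case False
  assume a: "a \<in> F"
  have "(*) a ` F = F"
    using a False finite_F by (intro endo_inj_surj) (auto simp: inj_on_def)
  then obtain b where "b \<in> F" "a * b = 1" using one_F by (metis imageE)
  then show ?thesis by (metis inverse_unique)
qed simp

lemma divide_F [simp]: "a \<in> F \<Longrightarrow> b \<in> F \<Longrightarrow> a / b \<in> F"
  by (simp add: divide_inverse)

lemma square_add: "(b + c) * (b + c) = b * b + (c * c :: 'k)"
proof -
  have "(b + c) * (b + c) = b * b + c * c + (b * c + b * c)"
    by (simp only: distrib_left distrib_right ac_simps)
  then show ?thesis by (simp only: add_self add_0_right)
qed

lemma square_eq_iff: "b * b = c * c \<longleftrightarrow> b = (c::'k)"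
  using square_add[of b c] add_eq_0[of b c] add_eq_0[of "b * b" "c * c"] mult_eq_0_iff[of "b + c" "b + c"]
  by metis

lemma sqrt_F:
  assumes "a \<in> F"
  shows "\<exists>b\<in>F. b * b = a"
proof -
  have "inj_on (\<lambda>b. b * b) F" by (rule inj_onI) (simp only: square_eq_iff)
  then have "(\<lambda>b. b * b) ` F = F" using finite_F by (intro endo_inj_surj) auto
  then have "a \<in> (\<lambda>b. b * b) ` F" using assms by simp
  then show ?thesis by blast
qed

text \<open>The map takes the value 0 at both 0 and 1, so on a finite field it is not injective and
  hence not surjective.\<close>

lemma irreducible_quadratic: "\<exists>d\<in>F. \<forall>a\<in>F. a * a + a \<noteq> d"
proof -
  let ?f = "\<lambda>a::'k. a * a + a"
  have "\<not> inj_on ?f F"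
    using inj_onD[of ?f F 0 1] zero_F one_F by (metis add_self mult_1 mult_zero_left zero_neq_one)
  then have "\<not> F \<subseteq> ?f ` F" using finite_surj_inj[OF finite_F, of ?f] by fast
  then obtain d where "d \<in> F" "d \<notin> ?f ` F" by (meson subsetI)
  then show ?thesis by (intro bexI[of _ d] ballI) (auto dest: sym)
qed

lemma q_ge_2: "2 \<le> q"
proof -
  have "card {0, 1::'k} \<le> q" using finite_F by (intro card_mono) auto
  then show ?thesis by simp
qed

definition V :: "'k vec4 set" where "V = F \<times> F \<times> F \<times> F"

lemma V_iff [simp]: "(a, b, c, d) \<in> V \<longleftrightarrow> a \<in> F \<and> b \<in> F \<and> c \<in> F \<and> d \<in> F"
  by (simp add: V_def)

lemma zero_V [simp]: "0 \<in> V" by (simp add: zero_prod_def)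

lemma add_V [simp]: "x \<in> V \<Longrightarrow> y \<in> V \<Longrightarrow> x + y \<in> V"
  by (cases x; cases y) simp

lemma smult_V [simp]: "k \<in> F \<Longrightarrow> x \<in> V \<Longrightarrow> k *v x \<in> V"
  by (cases x) simp

lemma sform_F [simp]: "x \<in> V \<Longrightarrow> y \<in> V \<Longrightarrow> sform x y \<in> F"
  by (cases x; cases y) simp

lemma finite_V: "finite V"
  using finite_F by (simp add: V_def)

lemma nondegenerate: "x \<in> V \<Longrightarrow> x \<noteq> 0 \<Longrightarrow> \<exists>y\<in>V. sform x y = 1"
proof -
  assume x: "x \<in> V" "x \<noteq> 0"
  obtain a b c d where abcd: "x = (a, b, c, d)" by (cases x)
  have "\<exists>y\<in>V. sform x y \<noteq> 0"
  proof (rule ccontr)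
    assume "\<not> ?thesis"
    then have *: "sform x y = 0" if "y \<in> V" for y using that by blast
    show False
      using *[of "(1,0,0,0)"] *[of "(0,1,0,0)"] *[of "(0,0,1,0)"] *[of "(0,0,0,1)"] x
      by (simp add: abcd zero_prod_def)
  qed
  then obtain y where y: "y \<in> V" "sform x y \<noteq> 0" by blast
  then show ?thesis using x by (intro bexI[of _ "inverse (sform x y) *v y"]) (auto simp: sform_linear)
qed

subsection \<open>Isometries\<close>

definition isometry :: "('k vec4 \<Rightarrow> 'k vec4) \<Rightarrow> bool" where
  "isometry g \<longleftrightarrow> (\<forall>x\<in>V. g x \<in> V) \<and> (\<forall>x\<in>V. \<forall>y\<in>V. g (x + y) = g x + g y) \<and>
    (\<forall>k\<in>F. \<forall>x\<in>V. g (k *v x) = k *v g x) \<and> (\<forall>x\<in>V. \<forall>y\<in>V. sform (g x) (g y) = sform x y)"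

lemma isometryD:
  assumes "isometry g"
  shows "x \<in> V \<Longrightarrow> g x \<in> V" "x \<in> V \<Longrightarrow> y \<in> V \<Longrightarrow> g (x + y) = g x + g y"
    "k \<in> F \<Longrightarrow> x \<in> V \<Longrightarrow> g (k *v x) = k *v g x"
    "x \<in> V \<Longrightarrow> y \<in> V \<Longrightarrow> sform (g x) (g y) = sform x y"
  using assms unfolding isometry_def by blast+

lemma isometry_comp: "isometry g \<Longrightarrow> isometry h \<Longrightarrow> isometry (g \<circ> h)"
  by (simp add: isometry_def)

lemma isometry_inj:
  assumes g: "isometry g" and x: "x \<in> V" "y \<in> V" "g x = g y"
  shows "x = y"
proof (rule ccontr)
  assume "x \<noteq> y"
  then obtain z where z: "z \<in> V" "sform (x + y) z = 1" using nondegenerate[of "x + y"] x by auto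
  have "sform (x + y) z = sform (g (x + y)) (g z)" using isometryD(4)[OF g] x z by simp
  also have "\<dots> = 0" using isometryD(2)[OF g] x by simp
  finally show False using z by simp
qed

lemma isometry_surj:
  assumes g: "isometry g" and x: "x \<in> V"
  shows "\<exists>y\<in>V. x = g y"
proof -
  have "inj_on g V" using isometry_inj[OF g] by (intro inj_onI)
  moreover have "g ` V \<subseteq> V" using isometryD(1)[OF g] by blast
  ultimately have "g ` V = V" using finite_V by (intro endo_inj_surj)
  then show ?thesis using x by blast
qed

text \<open>The transvection with centre \<open>x + y\<close>, scaled so that \<open>x\<close> is
  moved by exactly \<open>x + y\<close>, that is, to \<open>y\<close>. It fixes the polar hyperplane
  of its centre.\<close>

lemma isometry_transvection:
  assumes "x \<in> V" "y \<in> V" "sform x y \<noteq> 0"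
  shows "\<exists>g. isometry g \<and> g x = y \<and> (\<forall>u\<in>V. sform u (x + y) = 0 \<longrightarrow> g u = u)"
proof -
  define c where "c = inverse (sform x y)"
  define g where "g = (\<lambda>u. u + (c * sform u (x + y)) *v (x + y))"
  have c: "c \<in> F" "c * sform x y = 1" using assms by (auto simp: c_def)
  have "isometry g"
    unfolding isometry_def
  proof (intro conjI ballI)
    show "g u \<in> V" if "u \<in> V" for u using that c assms by (simp add: g_def)
    show "g (u + v) = g u + g v" for u v
      by (simp add: g_def sform_add_left smult4_add_left distrib_left ac_simps)
    show "g (k *v u) = k *v g u" for k u
      by (simp add: g_def sform_smult_left smult4_add_right smult4_smult4 ac_simps)
    show "sform (g u) (g v) = sform u v" for u v
    proof -
      let ?a = "x + y"
      have "sform (g u) (g v) = sform u v + (c * sform v ?a) * sform u ?a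
        + ((c * sform u ?a) * sform ?a v + (c * sform u ?a) * (c * sform v ?a) * sform ?a ?a)"
        unfolding g_def sform_linear by (simp only: distrib_left ac_simps)
      \<comment> \<open>The two cross terms coincide and cancel, and the quadratic term vanishes
        because the form is alternating.\<close>
      also have "\<dots> = sform u v"
        unfolding sform_self sform_commute[of ?a v] by (simp add: ac_simps)
      finally show ?thesis .
    qed
  qed
  moreover have "g x = y"
    using c by (simp add: g_def sform_add_right)
  moreover have "\<forall>u\<in>V. sform u (x + y) = 0 \<longrightarrow> g u = u"
    by (simp add: g_def)
  ultimately show ?thesis by blast
qed

lemma isometry_hyperbolic:
  assumes p: "p \<in> V" and x: "x \<in> V" "sform p x = 1" and y: "y \<in> V" "sform p y = 1"
  shows "\<exists>g. isometry g \<and> g p = p \<and> g x = y"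
proof (cases "sform x y = 0")
  case False
  moreover have "sform p (x + y) = 0" using assms by (simp add: sform_linear)
  ultimately show ?thesis using isometry_transvection[of x y] assms by blast
next
  case True
  \<comment> \<open>No single transvection joins orthogonal \<open>x\<close> and \<open>y\<close>,
    but \<open>p + x\<close> has product 1 with both, and both transvections of the detour fix
    \<open>p\<close>.\<close>
  let ?u = "p + x"
  have u: "sform x ?u \<noteq> 0" "sform ?u y \<noteq> 0" "?u \<in> V" "sform p (x + ?u) = 0" "sform p (?u + y) = 0"
    using assms True sform_commute[of x p] by (auto simp: sform_linear add.left_commute[of x p])
  obtain g where g: "isometry g" "g x = ?u" "g p = p"
    using isometry_transvection[of x ?u] u assms by blast
  obtain h where h: "isometry h" "h ?u = y" "h p = p"
    using isometry_transvection[of ?u y] u assms by blast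
  show ?thesis using isometry_comp[OF h(1) g(1)] g h by (intro exI[of _ "h \<circ> g"]) auto
qed

lemma polar_subset_imp_multiple:
  assumes v: "v \<in> V" "v \<noteq> 0" and w: "w \<in> V"
    and sub: "\<And>u. u \<in> V \<Longrightarrow> sform v u = 0 \<Longrightarrow> sform w u = 0"
  shows "\<exists>k\<in>F. w = k *v v"
proof -
  obtain v' where v': "v' \<in> V" "sform v v' = 1" using nondegenerate v by blast
  let ?k = "sform w v'"
  have "sform (w + ?k *v v) u = 0" if u: "u \<in> V" for u
  proof -
    \<comment> \<open>Adding this multiple of \<open>v'\<close> projects \<open>u\<close> into the
      polar of \<open>v\<close>.\<close>
    have "sform w (u + sform v u *v v') = 0"
      using sub[of "u + sform v u *v v'"] u v v' by (simp add: sform_linear)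
    then show ?thesis by (simp add: sform_linear mult.commute)
  qed
  then have "w + ?k *v v = 0" using nondegenerate[of "w + ?k *v v"] v v' w by fastforce
  then show ?thesis using v' w by auto
qed

text \<open>The polar of \<open>p\<close> is not the union of two proper subspaces.\<close>

lemma common_nonpolar:
  assumes "\<exists>u\<in>V. sform p u = 0 \<and> sform v u \<noteq> 0" "\<exists>u\<in>V. sform p u = 0 \<and> sform w u \<noteq> 0"
  shows "\<exists>u\<in>V. sform p u = 0 \<and> sform v u \<noteq> 0 \<and> sform w u \<noteq> 0"
proof -
  obtain a where a: "a \<in> V" "sform p a = 0" "sform v a \<noteq> 0" using assms by blast
  obtain b where b: "b \<in> V" "sform p b = 0" "sform w b \<noteq> 0" using assms by blast
  show ?thesis
  proof (cases "sform w a = 0 \<and> sform v b = 0")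
    case True
    then show ?thesis using a b by (intro bexI[of _ "a + b"]) (auto simp: sform_linear)
  next
    case False
    then show ?thesis using a b by blast
  qed
qed

text \<open>Two transvections through an intermediate vector \<open>u\<close> that is polar to
  \<open>p\<close> but to neither \<open>x\<close> nor \<open>y\<close>. With \<open>p = 0\<close>
  this gives transitivity on nonzero vectors.\<close>

lemma isometry_polar:
  assumes p: "p \<in> V" and x: "x \<in> V" "sform p x = 0" and y: "y \<in> V" "sform p y = 0"
    and xu: "\<exists>u\<in>V. sform p u = 0 \<and> sform x u \<noteq> 0" and yu: "\<exists>u\<in>V. sform p u = 0 \<and> sform y u \<noteq> 0"
  shows "\<exists>g. isometry g \<and> g p = p \<and> g x = y"
proof -
  obtain u where u: "u \<in> V" "sform p u = 0" "sform x u \<noteq> 0" "sform u y \<noteq> 0"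
    using common_nonpolar[OF xu yu] sform_commute by metis
  obtain g where g: "isometry g" "g x = u" "g p = p"
    using isometry_transvection[of x u] u assms by (auto simp: sform_linear)
  obtain h where h: "isometry h" "h u = y" "h p = p"
    using isometry_transvection[of u y] u assms by (auto simp: sform_linear)
  show ?thesis using isometry_comp[OF h(1) g(1)] g h by (intro exI[of _ "h \<circ> g"]) auto
qed

lemma isometry_transitive:
  assumes "x \<in> V" "x \<noteq> 0" "y \<in> V" "y \<noteq> 0"
  shows "\<exists>g. isometry g \<and> g x = y"
proof -
  have "\<exists>u\<in>V. sform 0 u = 0 \<and> sform z u \<noteq> 0" if "z \<in> V" "z \<noteq> 0" for z
    using nondegenerate[OF that] by (metis sform_zero(1) zero_neq_one)
  then show ?thesis using isometry_polar[of 0 x y] assms by auto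
qed

definition indep :: "'k vec4 \<Rightarrow> 'k vec4 \<Rightarrow> bool" where
  "indep x y \<longleftrightarrow> x \<noteq> 0 \<and> (\<forall>k\<in>F. y \<noteq> k *v x)"

lemma indep_ne_0: "indep x y \<Longrightarrow> x \<noteq> 0" "indep x y \<Longrightarrow> y \<noteq> 0"
  unfolding indep_def by (auto dest: bspec[of _ _ 0])

lemma indep_combination:
  assumes "indep x y" "a \<in> F" "b \<in> F" "a *v x + b *v y = 0"
  shows "a = 0" "b = 0"
proof -
  show b: "b = 0"
  proof (rule ccontr)
    assume "b \<noteq> 0"
    moreover have "a *v x = b *v y" using assms by simp
    ultimately have "y = (inverse b * a) *v x" by (simp flip: smult4_smult4) (simp add: smult4_smult4)
    moreover have "inverse b * a \<in> F" using assms by simp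
    ultimately show False using assms(1) unfolding indep_def by blast
  qed
  then show "a = 0" using assms by (simp add: indep_def smult4_eq_0)
qed

lemma indep_isometry:
  assumes g: "isometry g" and x: "x \<in> V" "y \<in> V" "indep x y"
  shows "indep (g x) (g y)"
  unfolding indep_def
proof (intro conjI ballI notI)
  assume "g x = 0"
  then have "g x = g (0 *v x)" using isometryD(3)[OF g, of 0 x] x by simp
  then show False using isometry_inj[OF g, of x "0 *v x"] x by (simp add: indep_def)
next
  fix k assume "k \<in> F" "g y = k *v g x"
  then have "g y = g (k *v x)" using isometryD(3)[OF g] x by simp
  then have "y = k *v x" using isometry_inj[OF g] x \<open>k \<in> F\<close> by simp
  then show False using x(3) \<open>k \<in> F\<close> unfolding indep_def by blast
qed

text \<open>The two-vector case of Witt's theorem, up to a scalar. Isometries preserve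
  \<open>sform\<close>, so a nonorthogonal pair can be matched only after rescaling; on projective
  points the scalar disappears.\<close>

lemma isometry_transitive_pairs:
  assumes xy: "x \<in> V" "y \<in> V" "indep x y" and xy': "x' \<in> V" "y' \<in> V" "indep x' y'"
    and iff: "sform x y = 0 \<longleftrightarrow> sform x' y' = 0"
  shows "\<exists>g k. isometry g \<and> k \<in> F \<and> k \<noteq> 0 \<and> g x = x' \<and> g y = k *v y'"
proof -
  obtain g where g: "isometry g" "g x = x'"
    using isometry_transitive[of x x'] xy xy' by (auto simp: indep_def)
  have ind: "indep x' (g y)" using indep_isometry[OF g(1) xy] g by simp
  have gy: "g y \<in> V" "sform x' (g y) = sform x y"
    using isometryD(1)[OF g(1), of y] isometryD(4)[OF g(1), of x y] g(2) xy by simp_all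
  have "\<exists>h k. isometry h \<and> k \<in> F \<and> k \<noteq> 0 \<and> h x' = x' \<and> h (g y) = k *v y'"
  proof (cases "sform x y = 0")
    case True
    \<comment> \<open>Otherwise the polar of \<open>x'\<close> would lie in that of
      \<open>z\<close>, making \<open>z\<close> a multiple of \<open>x'\<close>.\<close>
    have "\<exists>u\<in>V. sform x' u = 0 \<and> sform z u \<noteq> 0" if "z \<in> V" "indep x' z" for z
      using polar_subset_imp_multiple[of x' z] that xy' by (auto simp: indep_def)
    then obtain h where "isometry h" "h x' = x'" "h (g y) = y'"
      using isometry_polar[of x' "g y" y'] xy' gy ind True iff by auto
    then show ?thesis by (intro exI[of _ h] exI[of _ 1]) auto
  next
    case False
    let ?k = "sform x y" and ?l = "sform x' y'"
    have nz: "?k \<noteq> 0" "?l \<noteq> 0" "?k \<in> F" "?l \<in> F" using False iff xy xy' by auto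
    obtain h where h: "isometry h" "h x' = x'" "h (inverse ?k *v g y) = inverse ?l *v y'"
      using isometry_hyperbolic[of x' "inverse ?k *v g y" "inverse ?l *v y'"] xy' gy nz
      by (auto simp: sform_linear)
    have "g y = ?k *v (inverse ?k *v g y)" using nz by (simp add: smult4_smult4)
    then have "h (g y) = ?k *v (inverse ?l *v y')"
      using isometryD(3)[OF h(1), of ?k "inverse ?k *v g y"] h nz gy by simp
    then show ?thesis using h nz
      by (intro exI[of _ h] exI[of _ "?k * inverse ?l"]) (auto simp: smult4_smult4)
  qed
  then obtain h k where "isometry h" "k \<in> F" "k \<noteq> 0" "h x' = x'" "h (g y) = k *v y'" by blast
  then show ?thesis using isometry_comp[of h g] g
    by (intro exI[of _ "h \<circ> g"] exI[of _ k]) auto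
qed

text \<open>By transitivity it suffices to look at two pairs of standard basis vectors.\<close>

lemma polar_of_pair:
  assumes xy: "x \<in> V" "y \<in> V" "indep x y"
  shows "\<exists>a\<in>V. \<exists>b\<in>V. indep a b \<and>
    (\<forall>z\<in>V. sform x z = 0 \<and> sform y z = 0 \<longleftrightarrow> (\<exists>s\<in>F. \<exists>t\<in>F. z = s *v a + t *v b))"
proof -
  have std: ?thesis
    if e: "e \<in> V" "e' \<in> V" "indep e e'" "sform e e' = 0 \<longleftrightarrow> sform x y = 0"
      and f: "f \<in> V" "f' \<in> V" "indep f f'"
        "\<And>z. z \<in> V \<Longrightarrow> sform e z = 0 \<and> sform e' z = 0 \<longleftrightarrow> (\<exists>s\<in>F. \<exists>t\<in>F. z = s *v f + t *v f')"
    for e e' f f'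
  proof -
    obtain g k where g: "isometry g" "k \<in> F" "k \<noteq> 0" "g e = x" "g e' = k *v y"
      using isometry_transitive_pairs[of e e' x y] e xy by blast
    have "sform x z = 0 \<and> sform y z = 0 \<longleftrightarrow> (\<exists>s\<in>F. \<exists>t\<in>F. z = s *v g f + t *v g f')"
      if z: "z \<in> V" for z
    proof -
      obtain w where w: "w \<in> V" "z = g w" using isometry_surj[OF g(1) z] by blast
      have "sform x z = sform e w" "k * sform y z = sform e' w"
        using isometryD(4)[OF g(1)] e w g by (metis sform_smult_left)+
      then have "sform x z = 0 \<and> sform y z = 0 \<longleftrightarrow> sform e w = 0 \<and> sform e' w = 0"
        using g(3) by (metis mult_eq_0_iff)
      also have "\<dots> \<longleftrightarrow> (\<exists>s\<in>F. \<exists>t\<in>F. w = s *v f + t *v f')" using f w by blast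
      also have "\<dots> \<longleftrightarrow> (\<exists>s\<in>F. \<exists>t\<in>F. z = s *v g f + t *v g f')"
      proof -
        have "w = s *v f + t *v f' \<longleftrightarrow> z = s *v g f + t *v g f'" if "s \<in> F" "t \<in> F" for s t
        proof -
          have "s *v g f + t *v g f' = g (s *v f + t *v f')"
            using isometryD(2,3)[OF g(1)] that f by simp
          then show ?thesis using isometry_inj[OF g(1), of w "s *v f + t *v f'"] w f that by auto
        qed
        then show ?thesis by blast
      qed
      finally show ?thesis .
    qed
    moreover have "g f \<in> V" "g f' \<in> V" "indep (g f) (g f')"
      using isometryD(1)[OF g(1)] indep_isometry[OF g(1)] f by auto
    ultimately show ?thesis by blast
  qed
  show ?thesis
  proof (cases "sform x y = 0")
    case True
    have "sform (1,0,0,0) z = 0 \<and> sform (0,0,1,0) z = 0 \<longleftrightarrow>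
        (\<exists>s\<in>F. \<exists>t\<in>F. z = s *v (1,0,0,0) + t *v (0,0,1,0))" if "z \<in> V" for z
      using that by (cases z) simp
    then show ?thesis
      using True by (intro std[of "(1,0,0,0)" "(0,0,1,0)" "(1,0,0,0)" "(0,0,1,0)"])
        (simp_all add: indep_def zero_prod_def)
  next
    case False
    have "sform (1,0,0,0) z = 0 \<and> sform (0,1,0,0) z = 0 \<longleftrightarrow>
        (\<exists>s\<in>F. \<exists>t\<in>F. z = s *v (0,0,1,0) + t *v (0,0,0,1))" if "z \<in> V" for z
      using that by (cases z) auto
    then show ?thesis
      using False by (intro std[of "(1,0,0,0)" "(0,1,0,0)" "(0,0,1,0)" "(0,0,0,1)"])
        (simp_all add: indep_def zero_prod_def)
  qed
qed

end

subsection \<open>The symplectic quadrangle\<close>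

text \<open>Points are arbitrary labels that identify exactly the proportional vectors. This freedom
  allows them to be natural numbers, whatever the field.\<close>

locale symplectic_points = even_finite_field F for F :: "'k::field set" +
  fixes pt :: "'k vec4 \<Rightarrow> 'p"
  assumes pt_eq_iff: "\<lbrakk>v \<in> V; v \<noteq> 0; w \<in> V; w \<noteq> 0\<rbrakk> \<Longrightarrow> pt v = pt w \<longleftrightarrow> (\<exists>k\<in>F. w = k *v v)"
begin

definition points :: "'p set" where "points = pt ` (V - {0})"

definition rp :: "'p \<Rightarrow> 'k vec4" where "rp x = (SOME v. v \<in> V \<and> v \<noteq> 0 \<and> pt v = x)"

definition orth :: "'p \<Rightarrow> 'p \<Rightarrow> bool" where "orth x y \<longleftrightarrow> sform (rp x) (rp y) = 0"

lemma orth_sym: "orth x y \<Longrightarrow> orth y x"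
  by (simp add: orth_def sform_commute[of "rp y"])

lemma rp_props:
  assumes "x \<in> points" shows "rp x \<in> V" "rp x \<noteq> 0" "pt (rp x) = x"
proof -
  have "\<exists>v. v \<in> V \<and> v \<noteq> 0 \<and> pt v = x" using assms unfolding points_def by blast
  from someI_ex[OF this] show "rp x \<in> V" "rp x \<noteq> 0" "pt (rp x) = x"
    unfolding rp_def by blast+
qed

lemma pt_points: "v \<in> V \<Longrightarrow> v \<noteq> 0 \<Longrightarrow> pt v \<in> points"
  unfolding points_def by blast

lemma pt_smult: "k \<in> F \<Longrightarrow> k \<noteq> 0 \<Longrightarrow> v \<in> V \<Longrightarrow> v \<noteq> 0 \<Longrightarrow> pt (k *v v) = pt v"
  using pt_eq_iff[of v "k *v v"] by (auto simp: smult4_eq_0)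

lemma rp_pt:
  assumes "v \<in> V" "v \<noteq> 0" shows "\<exists>k\<in>F. k \<noteq> 0 \<and> rp (pt v) = k *v v"
proof -
  have "pt v = pt (rp (pt v))" using rp_props[OF pt_points[OF assms]] by simp
  then obtain k where "k \<in> F" "rp (pt v) = k *v v"
    using pt_eq_iff[OF assms] rp_props[OF pt_points[OF assms]] by blast
  moreover have "k \<noteq> 0" using calculation rp_props(2)[OF pt_points[OF assms]] by auto
  ultimately show ?thesis by blast
qed

lemma orth_pt_right: "v \<in> V \<Longrightarrow> v \<noteq> 0 \<Longrightarrow> orth x (pt v) \<longleftrightarrow> sform (rp x) v = 0"
  using rp_pt[of v] by (auto simp: orth_def sform_linear)

lemma orth_pt:
  "\<lbrakk>v \<in> V; v \<noteq> 0; w \<in> V; w \<noteq> 0\<rbrakk> \<Longrightarrow> orth (pt v) (pt w) \<longleftrightarrow> sform v w = 0"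
  using rp_pt[of v] by (auto simp: orth_pt_right sform_linear)

lemma indep_rp:
  assumes "x \<in> points" "y \<in> points" "x \<noteq> y"
  shows "indep (rp x) (rp y)"
  using pt_eq_iff[of "rp x" "rp y"] rp_props assms by (simp add: indep_def)

lemma pt_ne_indep: "\<lbrakk>v \<in> V; w \<in> V; indep v w\<rbrakk> \<Longrightarrow> pt v \<noteq> pt w"
  using pt_eq_iff[of v w] indep_ne_0[of v w] by (simp add: indep_def)

lemma finite_points: "finite points"
  using finite_V by (simp add: points_def)

lemma isometry_induces:
  assumes g: "isometry g"
  shows "(\<lambda>x\<in>points. pt (g (rp x))) \<in> aut_group points orth"
proof -
  let ?h = "\<lambda>x\<in>points. pt (g (rp x))"
  have gV: "g (rp x) \<in> V" "g (rp x) \<noteq> 0" if "x \<in> points" for x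
  proof -
    show "g (rp x) \<in> V" using isometryD(1)[OF g] rp_props[OF that] by simp
    have "g 0 = 0" using isometryD(3)[OF g, of 0 0] by simp
    then show "g (rp x) \<noteq> 0" using isometry_inj[OF g, of "rp x" 0] rp_props[OF that] by auto
  qed
  have "inj_on ?h points"
  proof (rule inj_onI)
    fix x y assume xy: "x \<in> points" "y \<in> points" "?h x = ?h y"
    then obtain k where k: "k \<in> F" "g (rp y) = k *v g (rp x)"
      using pt_eq_iff[of "g (rp x)" "g (rp y)"] gV by auto
    then have "g (rp y) = g (k *v rp x)" using isometryD(3)[OF g] rp_props xy by simp
    then have "rp y = k *v rp x" using isometry_inj[OF g] rp_props xy k by simp
    then show "x = y" using indep_rp[OF xy(1,2)] k unfolding indep_def by blast
  qed
  moreover have "?h ` points \<subseteq> points" by (simp add: image_subset_iff gV pt_points)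
  ultimately have "bij_betw ?h points points"
    using finite_points by (simp add: bij_betw_def endo_inj_surj)
  moreover have "orth (?h x) (?h y) \<longleftrightarrow> orth x y" if "x \<in> points" "y \<in> points" for x y
    using that gV isometryD(4)[OF g] rp_props by (simp add: orth_pt) (simp add: orth_def)
  ultimately show ?thesis by (simp add: aut_group_def Bij_def)
qed

lemma points_transitive_pairs:
  assumes "x \<in> points" "y \<in> points" "x' \<in> points" "y' \<in> points" "x \<noteq> y" "x' \<noteq> y'"
    and "orth x y \<longleftrightarrow> orth x' y'"
  shows "\<exists>g\<in>aut_group points orth. g x = x' \<and> g y = y'"
proof -
  obtain g k where g: "isometry g" "k \<in> F" "k \<noteq> 0" "g (rp x) = rp x'" "g (rp y) = k *v rp y'"
    using isometry_transitive_pairs[of "rp x" "rp y" "rp x'" "rp y'"] assms rp_props indep_rp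
    unfolding orth_def by metis
  then show ?thesis
    using isometry_induces[OF g(1)] assms(1-4) rp_props[OF assms(3)] rp_props[OF assms(4)]
    by (intro bexI[of _ "\<lambda>x\<in>points. pt (g (rp x))"]) (simp_all add: pt_smult)
qed

lemma common_perp_basis:
  assumes "x \<in> points" "y \<in> points" "x \<noteq> y"
  obtains a b where "a \<in> V" "b \<in> V" "indep a b"
    "\<And>s t. s \<in> F \<Longrightarrow> t \<in> F \<Longrightarrow> s *v a + t *v b \<noteq> 0 \<Longrightarrow> pt (s *v a + t *v b) \<in> common_perp points orth x y"
    "\<And>z. z \<in> common_perp points orth x y \<Longrightarrow> \<exists>s\<in>F. \<exists>t\<in>F. rp z = s *v a + t *v b"
proof -
  obtain a b where ab: "a \<in> V" "b \<in> V" "indep a b" and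
    *: "\<And>z. z \<in> V \<Longrightarrow> sform (rp x) z = 0 \<and> sform (rp y) z = 0 \<longleftrightarrow> (\<exists>s\<in>F. \<exists>t\<in>F. z = s *v a + t *v b)"
    using polar_of_pair[OF rp_props(1)[OF assms(1)] rp_props(1)[OF assms(2)] indep_rp[OF assms]]
    by blast
  show ?thesis
  proof (rule that[OF ab])
    show "pt (s *v a + t *v b) \<in> common_perp points orth x y"
      if "s \<in> F" "t \<in> F" "s *v a + t *v b \<noteq> 0" for s t
    proof -
      have v: "s *v a + t *v b \<in> V" using ab that by simp
      have "sform (rp x) (s *v a + t *v b) = 0" "sform (rp y) (s *v a + t *v b) = 0"
        using *[OF v] that(1,2) by blast+
      then show ?thesis using pt_points[OF v that(3)]
        unfolding common_perp_def using orth_pt_right[OF v that(3)] by blast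
    qed
    show "\<exists>s\<in>F. \<exists>t\<in>F. rp z = s *v a + t *v b" if "z \<in> common_perp points orth x y" for z
      using *[of "rp z"] that rp_props[of z] unfolding common_perp_def orth_def by blast
  qed
qed

text \<open>The points of a projective line are \<open>a + t *v b\<close> for \<open>t\<close> in
  \<open>F\<close>, together with \<open>b\<close> as point at infinity.\<close>

lemma card_common_perp:
  assumes "x \<in> points" "y \<in> points" "x \<noteq> y"
  shows "card (common_perp points orth x y) = Suc q"
proof -
  obtain a b where ab: "a \<in> V" "b \<in> V" "indep a b"
    and pts: "\<And>s t. s \<in> F \<Longrightarrow> t \<in> F \<Longrightarrow> s *v a + t *v b \<noteq> 0 \<Longrightarrow> pt (s *v a + t *v b) \<in> common_perp points orth x y"
    and span: "\<And>z. z \<in> common_perp points orth x y \<Longrightarrow> \<exists>s\<in>F. \<exists>t\<in>F. rp z = s *v a + t *v b"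
    using common_perp_basis[OF assms] by metis
  have b0: "b \<noteq> 0" using indep_ne_0 ab by blast
  let ?f = "\<lambda>t. pt (a + t *v b)"
  have af: "a + t *v b \<noteq> 0" "a + t *v b \<in> V" if "t \<in> F" for t
    using indep_combination[OF ab(3), of 1 t] that ab by auto
  have inj: "inj_on ?f F"
  proof (rule inj_onI)
    fix s t assume st: "s \<in> F" "t \<in> F" "?f s = ?f t"
    then obtain k where k: "k \<in> F" "a + t *v b = k *v (a + s *v b)"
      using pt_eq_iff[OF af(2)[of s] af(1)[of s] af(2)[of t] af(1)[of t]] by blast
    have "(1 + k) *v a + (t + k * s) *v b = (a + t *v b) + k *v (a + s *v b)"
      by (simp add: smult4_add_left smult4_add_right smult4_smult4 ac_simps)
    also have "\<dots> = 0" unfolding k(2)[symmetric] by (rule vadd_self)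
    finally have "1 + k = 0" "t + k * s = 0"
      using indep_combination[OF ab(3), of "1 + k" "t + k * s"] k st by simp_all
    then show "s = t" by simp
  qed
  have nb: "pt b \<notin> ?f ` F"
  proof
    assume "pt b \<in> ?f ` F"
    then obtain t where t: "t \<in> F" "pt b = pt (a + t *v b)" by blast
    then obtain k where k: "k \<in> F" "a + t *v b = k *v b"
      using pt_eq_iff[OF ab(2) b0 af(2) af(1)] by blast
    have "1 *v a + (t + k) *v b = (a + t *v b) + k *v b"
      by (simp add: smult4_add_left ac_simps)
    also have "\<dots> = 0" unfolding k(2) by (rule vadd_self)
    finally show False using indep_combination(1)[OF ab(3), of 1 "t + k"] k t by simp
  qed
  have "common_perp points orth x y = insert (pt b) (?f ` F)"
  proof (intro equalityI subsetI)
    fix z assume z: "z \<in> common_perp points orth x y"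
    then have zp: "z \<in> points" by (simp add: common_perp_def)
    obtain s t where st: "s \<in> F" "t \<in> F" "rp z = s *v a + t *v b" using span z by blast
    have z_pt: "z = pt (s *v a + t *v b)" "s *v a + t *v b \<noteq> 0"
      using rp_props[OF zp] st by auto
    show "z \<in> insert (pt b) (?f ` F)"
    proof (cases "s = 0")
      case True
      then have "t \<noteq> 0" "z = pt (t *v b)" using z_pt by auto
      then show ?thesis using pt_smult[OF st(2) _ ab(2) b0] by simp
    next
      case False
      have "s *v a + t *v b = s *v (a + (t / s) *v b)"
        using False by (simp add: smult4_add_right smult4_smult4)
      then have "z = ?f (t / s)" using z_pt(1) pt_smult[OF st(1) False] af[of "t / s"] st by simp
      then show ?thesis using st by simp
    qed
  next
    fix z assume "z \<in> insert (pt b) (?f ` F)"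
    then show "z \<in> common_perp points orth x y"
      using pts[of 0 1] b0 pts[of 1] af by auto
  qed
  then show ?thesis using inj nb finite_F by (simp add: card_image)
qed

text \<open>Cramer's rule with plus signs: \<open>z\<close> and \<open>z'\<close> give two equations
  for the products of \<open>a\<close> and \<open>b\<close> with \<open>rp w\<close>. The
  determinant \<open>?d\<close> is nonzero because distinct points are independent, so both products
  vanish.\<close>

lemma common_perp_two_determine:
  assumes xy: "x \<in> points" "y \<in> points" "x \<noteq> y"
    and z: "z \<in> common_perp points orth x y" "z' \<in> common_perp points orth x y" "z \<noteq> z'"
    and w: "orth z w" "orth z' w" and u: "u \<in> common_perp points orth x y"
  shows "orth u w"
proof -
  obtain a b where ab: "a \<in> V" "b \<in> V" "indep a b"
    and span: "\<And>z. z \<in> common_perp points orth x y \<Longrightarrow> \<exists>s\<in>F. \<exists>t\<in>F. rp z = s *v a + t *v b"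
    using common_perp_basis[OF xy] by metis
  have zp: "z \<in> points" "z' \<in> points" using z by (auto simp: common_perp_def)
  obtain s t where st: "s \<in> F" "t \<in> F" "rp z = s *v a + t *v b" using span z by blast
  obtain s' t' where st': "s' \<in> F" "t' \<in> F" "rp z' = s' *v a + t' *v b" using span z by blast
  let ?A = "sform a (rp w)" and ?B = "sform b (rp w)" and ?d = "s * t' + s' * t"
  have eqs: "s * ?A + t * ?B = 0" "s' * ?A + t' * ?B = 0"
    using w st st' by (simp_all add: orth_def sform_linear)
  have d: "?d \<noteq> 0"
  proof
    assume d: "?d = 0"
    have ind: "indep (rp z) (rp z')" by (rule indep_rp) (use zp z in auto)
    have "t' *v rp z + t *v rp z' = ?d *v a + (t * t' + t * t') *v b"
      unfolding st(3) st'(3)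
      by (simp only: smult4_add_left smult4_add_right smult4_smult4 ac_simps)
    then have "t' *v rp z + t *v rp z' = 0" using d by simp
    then have tt: "t' = 0" "t = 0" using indep_combination[OF ind, of t' t] st st' by auto
    have "s' *v rp z + s *v rp z' = (s * s' + s * s') *v a"
      unfolding st(3) st'(3) tt
      by (simp add: smult4_smult4 ac_simps)
    then have "s' *v rp z + s *v rp z' = 0" by simp
    then have "s = 0" using indep_combination[OF ind, of s' s] st st' by auto
    then show False using tt st rp_props(2)[OF zp(1)] by simp
  qed
  have "?d * ?A = t' * (s * ?A + t * ?B) + t * (s' * ?A + t' * ?B) + (t * t' * ?B + t * t' * ?B)"
    by (simp only: distrib_left distrib_right ac_simps) simp
  then have A: "?A = 0" using eqs d by simp
  have "?d * ?B = s' * (s * ?A + t * ?B) + s * (s' * ?A + t' * ?B) + (s * s' * ?A + s * s' * ?A)"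
    by (simp only: distrib_left distrib_right ac_simps) simp
  then have B: "?B = 0" using eqs d by simp
  show ?thesis using span[OF u] A B by (auto simp: orth_def sform_linear)
qed

lemma common_perp_meets:
  assumes xy: "x \<in> points" "y \<in> points" "x \<noteq> y" and w: "w \<in> points"
  shows "\<exists>z\<in>common_perp points orth x y. orth z w"
proof -
  obtain a b where ab: "a \<in> V" "b \<in> V" "indep a b"
    and pts: "\<And>s t. s \<in> F \<Longrightarrow> t \<in> F \<Longrightarrow> s *v a + t *v b \<noteq> 0 \<Longrightarrow> pt (s *v a + t *v b) \<in> common_perp points orth x y"
    using common_perp_basis[OF xy] by metis
  let ?A = "sform a (rp w)" and ?B = "sform b (rp w)"
  have AB: "?A \<in> F" "?B \<in> F" using ab rp_props[OF w] by simp_all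
  have "\<exists>s\<in>F. \<exists>t\<in>F. (s \<noteq> 0 \<or> t \<noteq> 0) \<and> s * ?A + t * ?B = 0"
  proof (cases "?A = 0")
    case True
    then show ?thesis by (intro bexI[of _ 1] bexI[of _ 0]) auto
  next
    case False
    then show ?thesis using AB by (intro bexI[of _ ?B] bexI[of _ ?A]) (auto simp: mult.commute)
  qed
  then obtain s t where st: "s \<in> F" "t \<in> F" "s \<noteq> 0 \<or> t \<noteq> 0" "s * ?A + t * ?B = 0" by blast
  then have ne: "s *v a + t *v b \<noteq> 0" using indep_combination[OF ab(3)] by blast
  have v: "s *v a + t *v b \<in> V" using ab st by simp
  have "sform (rp w) (s *v a + t *v b) = 0"
    using st(4) by (simp add: sform_linear sform_commute[of "rp w"])
  then have "orth w (pt (s *v a + t *v b))" using orth_pt_right[OF v ne] by simp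
  then show ?thesis using pts[OF st(1,2) ne] orth_sym by blast
qed

sublocale quadrangle: symplectic_quadrangle points orth q
proof
  show "finite points" by (rule finite_points)
  show "points \<noteq> {}" using pt_points[of "(1, 0, 0, 0)"] by (auto simp: zero_prod_def)
  show "even q" by (rule card_even)
  show "0 < q" using q_ge_2 by simp
  show "orth x x" for x by (simp add: orth_def)
  show "orth x y \<Longrightarrow> orth y x" for x y by (rule orth_sym)
  show "\<exists>y\<in>points. \<not> orth x y" if x: "x \<in> points" for x
  proof -
    obtain v where v: "v \<in> V" "sform (rp x) v = 1" using nondegenerate rp_props[OF x] by blast
    then have "v \<noteq> 0" by auto
    then show ?thesis using v pt_points orth_pt_right[of v x] by (metis zero_neq_one)
  qed
qed (rule card_common_perp common_perp_meets points_transitive_pairs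
    common_perp_two_determine; assumption)+

subsection \<open>An elliptic quadric and a regular spread\<close>

text \<open>A hyperbolic plane plus c^2 + cd + ed^2, the norm form of the quadratic extension when
  t^2 + t + e has no root. Its polarization is \<open>sform\<close>, and its singular points form
  the elliptic quadric.\<close>

fun quad :: "'k \<Rightarrow> 'k vec4 \<Rightarrow> 'k" where
  "quad e (a, b, c, d) = a * b + c * c + c * d + e * (d * d)"

text \<open>
  Multiplication by a root of \<open>t\<^sup>2 + t + e\<close>, acting by a matrix on \<open>(a, c)\<close> and by its transpose on
  \<open>(b, d)\<close>, so that the form \<open>sform v (mulJ e w)\<close> is again alternating.
\<close>

fun mulJ :: "'k \<Rightarrow> 'k vec4 \<Rightarrow> 'k vec4" where
  "mulJ e (a, b, c, d) = (e * c, d, a + c, e * b + d)"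

lemma quad_add: "quad e (v + w) = quad e v + quad e w + sform v w"
  by (cases v; cases w) (simp add: algebra_simps)

lemma quad_smult: "quad e (k *v v) = k * k * quad e v"
  by (cases v) (simp add: algebra_simps)

lemma sform_mulJ_commute: "sform (mulJ e v) w = sform v (mulJ e w)"
  by (cases v; cases w) (simp add: algebra_simps)

lemma sform_mulJ_self: "sform v (mulJ e v) = 0"
  by (cases v) (simp add: algebra_simps)

lemma mulJ_mulJ: "mulJ e (mulJ e v) = mulJ e v + e *v v"
  by (cases v) (simp add: algebra_simps)

lemma mulJ_smult: "mulJ e (k *v v) = k *v mulJ e v"
  by (cases v) (simp add: algebra_simps)

lemma mulJ_V: "e \<in> F \<Longrightarrow> v \<in> V \<Longrightarrow> mulJ e v \<in> V"
  by (cases v) simp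

text \<open>The plane spanned by \<open>v\<close> and \<open>w\<close> contains nonzero vectors with
  first, respectively second, coordinate 0. Singularity and anisotropy of the norm form reduce them
  to multiples of the two basis vectors of a hyperbolic plane, which are not orthogonal.\<close>

lemma quad_no_singular_line:
  assumes e: "e \<in> F" "\<And>a. a \<in> F \<Longrightarrow> a * a + a \<noteq> e"
    and v: "v \<in> V" and w: "w \<in> V" and ind: "indep v w"
    and zero: "quad e v = 0" "quad e w = 0" "sform v w = 0"
  shows False
proof -
  have span: "quad e (s *v v + t *v w) = 0" for s t
    using zero by (simp add: quad_add quad_smult sform_linear)
  have span2: "sform (s *v v + t *v w) (s' *v v + t' *v w) = 0" for s t s' t'
    using zero sform_commute[of w v] by (simp add: sform_linear)
  \<comment> \<open>Anisotropy of the norm form: for nonzero \<open>d\<close>, division by its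
    square makes \<open>c / d\<close> a root of t^2 + t + e.\<close>
  have cd: "c = 0 \<and> d = 0" if "c \<in> F" "d \<in> F" "c * c + c * d + e * (d * d) = 0" for c d
  proof (cases "d = 0")
    case False
    have "(c / d) * (c / d) + c / d + e = (c * c + c * d + e * (d * d)) / (d * d)"
      using False by (simp add: field_simps)
    then have "(c / d) * (c / d) + c / d + e = 0" using that by simp
    then have "(c / d) * (c / d) + c / d = e" by simp
    then show ?thesis using e(2)[of "c / d"] that by simp
  qed (use that in auto)
  obtain a b c d where va: "v = (a, b, c, d)" by (cases v)
  obtain a' b' c' d' where wa: "w = (a', b', c', d')" by (cases w)
  have mem: "a \<in> F" "b \<in> F" "c \<in> F" "d \<in> F" "a' \<in> F" "b' \<in> F" "c' \<in> F" "d' \<in> F"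
    using v w va wa by auto
  have kill: "\<exists>s\<in>F. \<exists>t\<in>F. (s \<noteq> 0 \<or> t \<noteq> 0) \<and> s * f + t * f' = 0"
    if "f \<in> F" "f' \<in> F" for f f'
  proof (cases "f = 0")
    case True
    then show ?thesis by (intro bexI[of _ 1] bexI[of _ 0]) auto
  next
    case False
    then show ?thesis using that by (intro bexI[of _ f'] bexI[of _ f]) (auto simp: mult.commute)
  qed
  obtain s t where st: "s \<in> F" "t \<in> F" "s \<noteq> 0 \<or> t \<noteq> 0" "s * a + t * a' = 0" using kill mem by blast
  obtain s' t' where st': "s' \<in> F" "t' \<in> F" "s' \<noteq> 0 \<or> t' \<noteq> 0" "s' * b + t' * b' = 0" using kill mem by blast
  have 1: "s *v v + t *v w = (0, s * b + t * b', s * c + t * c', s * d + t * d')"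
    using st by (simp add: va wa)
  have 2: "s' *v v + t' *v w = (s' * a + t' * a', 0, s' * c + t' * c', s' * d + t' * d')"
    using st' by (simp add: va wa)
  have 3: "s * c + t * c' = 0 \<and> s * d + t * d' = 0"
    by (rule cd) (use span[of s t, unfolded 1] st mem in auto)
  have 4: "s' * c + t' * c' = 0 \<and> s' * d + t' * d' = 0"
    by (rule cd) (use span[of s' t', unfolded 2] st' mem in auto)
  have "s *v v + t *v w \<noteq> 0" "s' *v v + t' *v w \<noteq> 0"
    using indep_combination[OF ind] st st' by blast+
  then have "s * b + t * b' \<noteq> 0" "s' * a + t' * a' \<noteq> 0"
    unfolding 1 2 using 3 4 by (auto simp: zero_prod_def)
  moreover have "(s * b + t * b') * (s' * a + t' * a') = 0"
    using span2[of s t s' t'] unfolding 1 2 using 3 4 by simp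
  ultimately show False by simp
qed

text \<open>On a totally isotropic line the cross term of \<open>quad\<close> vanishes, so
  \<open>quad\<close> is there the square of a linear form and has a zero. Two zeros would give a
  totally singular line.\<close>

lemma exists_ovoid: "\<exists>U. ovoid_of points orth U"
proof -
  obtain e where e: "e \<in> F" "\<And>a. a \<in> F \<Longrightarrow> a * a + a \<noteq> e" using irreducible_quadratic by blast
  define U where "U = {x \<in> points. quad e (rp x) = 0}"
  have "card (U \<inter> L) = 1" if L: "line_of points orth L" for L
  proof -
    obtain x y where xy: "x \<in> points" "y \<in> points" "x \<noteq> y" "orth x y" "L = common_perp points orth x y"
      using L by (auto simp: line_of_def)
    have r: "rp x \<in> V" "rp y \<in> V" "indep (rp x) (rp y)" "sform (rp x) (rp y) = 0"
      using xy rp_props indep_rp by (simp_all add: orth_def)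
    have qF: "quad e v \<in> F" if "v \<in> V" for v using that e by (cases v) simp
    obtain s where s: "s \<in> F" "s * s = quad e (rp y)" using sqrt_F qF r by metis
    obtain t where t: "t \<in> F" "t * t = quad e (rp x)" using sqrt_F qF r by metis
    \<comment> \<open>The weights are the crossed square roots \<open>s\<close> and
      \<open>t\<close>, so that the two equal products cancel; if both roots are 0, any vector of
      the plane is singular.\<close>
    obtain s' t' where st': "s' \<in> F" "t' \<in> F" "s' \<noteq> 0 \<or> t' \<noteq> 0"
      "s' * s' * (t * t) + t' * t' * (s * s) = 0"
    proof (cases "s = 0 \<and> t = 0")
      case True
      then show ?thesis using that[of 1 0] by simp
    next
      case False
      then show ?thesis using that[of s t] s t by (simp add: mult.commute)
    qed
    let ?v = "s' *v rp x + t' *v rp y"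
    have v: "?v \<in> V" "?v \<noteq> 0" using r st' indep_combination[OF r(3), of s' t'] by auto
    have qv: "quad e ?v = 0" using st' s t r by (simp add: quad_add quad_smult sform_linear)
    have "sform (rp x) ?v = 0" "sform (rp y) ?v = 0"
      using r sform_commute[of "rp y" "rp x"] by (simp_all add: sform_linear)
    then have "pt ?v \<in> L" using xy v pt_points by (simp add: common_perp_def orth_pt_right)
    moreover have "quad e (rp (pt ?v)) = 0" using rp_pt[OF v] qv by (auto simp: quad_smult)
    ultimately have "pt ?v \<in> U \<inter> L" using pt_points[OF v] by (simp add: U_def)
    moreover have "u = u'" if u: "u \<in> U \<inter> L" "u' \<in> U \<inter> L" for u u'
    proof (rule ccontr)
      assume ne: "u \<noteq> u'"
      have "u \<in> points" "u' \<in> points" "quad e (rp u) = 0" "quad e (rp u') = 0" "orth u u'"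
        using u quadrangle.lineE(2)[OF L _ _ ne] by (auto simp: U_def)
      then show False
        using quad_no_singular_line[OF e, of "rp u" "rp u'"] rp_props indep_rp ne by (simp add: orth_def)
    qed
    ultimately have "U \<inter> L = {pt ?v}" by blast
    then show ?thesis by simp
  qed
  moreover have "U \<subseteq> points" by (simp add: U_def)
  ultimately have "ovoid_of points orth U" by (simp add: ovoid_of_def)
  then show ?thesis by blast
qed

text \<open>\<open>mulJ\<close> turns the 4-space into a plane over the quadratic extension. The
  1-dimensional subspaces over the extension partition the nonzero vectors, and they are totally
  isotropic because \<open>sform v (mulJ e v)\<close> vanishes.\<close>

lemma exists_spread: "\<exists>P. partition_on points P \<and> (\<forall>T\<in>P. line_of points orth T)"
proof -
  obtain e where e: "e \<in> F" "\<And>a. a \<in> F \<Longrightarrow> a * a + a \<noteq> e" using irreducible_quadratic by blast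
  define j where "j = (\<lambda>x. pt (mulJ e (rp x)))"
  define T where "T = (\<lambda>x. common_perp points orth x (j x))"
  have J: "mulJ e (rp x) \<in> V" "indep (rp x) (mulJ e (rp x))" if x: "x \<in> points" for x
  proof -
    show "mulJ e (rp x) \<in> V" using mulJ_V e rp_props[OF x] by blast
    show "indep (rp x) (mulJ e (rp x))"
      unfolding indep_def
    proof (intro conjI ballI notI)
      \<comment> \<open>An eigenvalue of \<open>mulJ e\<close> in \<open>F\<close> would be a root
        of t^2 + t + e.\<close>
      fix k assume k: "k \<in> F" "mulJ e (rp x) = k *v rp x"
      have "mulJ e (mulJ e (rp x)) = (k * k) *v rp x"
        by (simp add: k(2) mulJ_smult smult4_smult4)
      moreover have "mulJ e (mulJ e (rp x)) = k *v rp x + e *v rp x"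
        using mulJ_mulJ[of e "rp x"] k(2) by simp
      ultimately have "(k * k + k + e) *v rp x = (k *v rp x + e *v rp x) + (k *v rp x + e *v rp x)"
        by (simp only: smult4_add_left add.assoc)
      also have "\<dots> = 0" by (rule vadd_self)
      finally have "(k * k + k + e) *v rp x = 0" .
      then have "k * k + k + e = 0" using rp_props(2)[OF x] by (simp add: smult4_eq_0)
      then show False using e(2)[OF k(1)] by simp
    qed (use rp_props(2)[OF x] in simp)
  qed
  have jx: "j x \<in> points" "x \<noteq> j x" "orth x (j x)" if x: "x \<in> points" for x
  proof -
    have ne: "mulJ e (rp x) \<noteq> 0" using indep_ne_0(2)[OF J(2)[OF x]] .
    show "j x \<in> points" using pt_points[OF J(1)[OF x] ne] by (simp add: j_def)
    show "x \<noteq> j x" using pt_ne_indep[OF _ J[OF x]] rp_props[OF x] unfolding j_def by metis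
    show "orth x (j x)" using orth_pt_right[OF J(1)[OF x] ne] by (simp add: j_def sform_mulJ_self)
  qed
  have orth_j: "orth z (j x) \<longleftrightarrow> sform (rp z) (mulJ e (rp x)) = 0" if "x \<in> points" for x z
    using orth_pt_right[OF J(1)[OF that] indep_ne_0(2)[OF J(2)[OF that]]] by (simp add: j_def)
  have mem_T: "z \<in> T x \<longleftrightarrow> z \<in> points \<and> orth x z \<and> sform (rp z) (mulJ e (rp x)) = 0"
    if "x \<in> points" for x z
    using orth_j[OF that, of z] quadrangle.rel_sym by (auto simp: T_def common_perp_def)
  have line: "line_of points orth (T x)" if "x \<in> points" for x
    using jx[OF that] that by (auto simp: line_of_def T_def)
  have self: "x \<in> T x" if "x \<in> points" for x
    using that by (simp add: mem_T sform_mulJ_self)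
  have T_eq: "T z = T x" if x: "x \<in> points" and z: "z \<in> T x" for x z
  proof -
    have zp: "z \<in> points" "orth x z" "sform (rp z) (mulJ e (rp x)) = 0" using z mem_T[OF x] by auto
    then have zx: "sform (mulJ e (rp z)) (rp x) = 0" "sform (rp z) (rp x) = 0"
      by (simp_all add: sform_mulJ_commute orth_def sform_commute[of "rp z" "rp x"])
    have "sform (rp x) (mulJ e (rp z)) = 0" using zx sform_commute by metis
    then have "orth x (j z)" using orth_j[OF zp(1)] by simp
    \<comment> \<open>By self-adjointness and the quadratic equation of \<open>mulJ e\<close>, this
      is the product of \<open>rp z\<close> with \<open>mulJ e (rp x) + e *v rp x\<close>, and both
      terms vanish.\<close>
    moreover have "sform (mulJ e (rp z)) (mulJ e (rp x)) = 0"
      using zx by (simp add: sform_mulJ_commute[of e "rp z"] mulJ_mulJ sform_linear zp(3))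
    then have "orth (j z) (j x)"
      using orth_j[OF x, of "j z"] rp_pt[OF J(1)[OF zp(1)] indep_ne_0(2)[OF J(2)[OF zp(1)]]]
      by (auto simp: j_def sform_linear)
    ultimately have "j z \<in> T x"
      using jx(1)[OF zp(1)] quadrangle.rel_sym by (auto simp: T_def common_perp_def)
    \<comment> \<open>The line \<open>T x\<close> contains both \<open>z\<close> and
      \<open>j z\<close>, which determine \<open>T z\<close>.\<close>
    then show ?thesis
      using quadrangle.lineE(1)[OF line[OF x] z _ jx(2)[OF zp(1)]] by (simp add: T_def)
  qed
  have "partition_on points (T ` points)"
  proof (rule partition_onI)
    show "\<Union>(T ` points) = points" using self mem_T by blast
    show "{} \<notin> T ` points" using self by blast
    show "disjnt A B" if "A \<in> T ` points" "B \<in> T ` points" "A \<noteq> B" for A B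
      using that T_eq unfolding disjnt_def by blast
  qed
  then show ?thesis using line by blast
qed

end

subsection \<open>Fields of even order\<close>

lemma (in even_finite_field) exists_point_labelling: "\<exists>pt :: 'k vec4 \<Rightarrow> nat. symplectic_points F pt"
proof -
  define cls where "cls = (\<lambda>v :: 'k vec4. (\<lambda>k. k *v v) ` (F - {0}))"
  have cls_iff: "cls v = cls w \<longleftrightarrow> (\<exists>k\<in>F. w = k *v v)" if vw: "v \<noteq> 0" "w \<noteq> 0" for v w
  proof
    assume "cls v = cls w"
    moreover have "w \<in> cls w" unfolding cls_def by (rule image_eqI[of _ _ 1]) auto
    ultimately have "w \<in> cls v" by simp
    then show "\<exists>k\<in>F. w = k *v v" unfolding cls_def by blast
  next
    assume "\<exists>k\<in>F. w = k *v v"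
    then obtain k where k: "k \<in> F" "w = k *v v" by blast
    then have k0: "k \<noteq> 0" using vw by auto
    have "l *v w \<in> cls v" if "l \<in> F - {0}" for l
      unfolding cls_def by (rule image_eqI[of _ _ "l * k"]) (use that k k0 in \<open>auto simp: smult4_smult4\<close>)
    moreover have "l *v v \<in> cls w" if "l \<in> F - {0}" for l
      unfolding cls_def by (rule image_eqI[of _ _ "l / k"]) (use that k k0 in \<open>auto simp: smult4_smult4\<close>)
    ultimately show "cls v = cls w" unfolding cls_def by blast
  qed
  obtain f :: "'k vec4 set \<Rightarrow> nat" where f: "inj_on f (cls ` V)"
    using finite_imp_inj_to_nat_seg[of "cls ` V"] finite_V by blast
  have "symplectic_points F (f \<circ> cls)"
  proof
    fix v w :: "'k vec4" assume vw: "v \<in> V" "v \<noteq> 0" "w \<in> V" "w \<noteq> 0"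
    then have "(f \<circ> cls) v = (f \<circ> cls) w \<longleftrightarrow> cls v = cls w"
      using inj_on_eq_iff[OF f, of "cls v" "cls w"] by simp
    then show "(f \<circ> cls) v = (f \<circ> cls) w \<longleftrightarrow> (\<exists>k\<in>F. w = k *v v)"
      using cls_iff vw by simp
  qed
  then show ?thesis by blast
qed

text \<open>The degree bound is what later separates isomorphism classes; it holds since a line
  already has \<open>q + 1\<close> points.\<close>

lemma (in even_finite_field) exists_parameter_2_group:
  "\<exists>X G. finite (X :: nat set) \<and> primitive_perm_group X G \<and> non_synchronizing X G \<and>
    group_parameter X G = 2 \<and> q < card X"
proof -
  obtain pt :: "'k vec4 \<Rightarrow> nat" where "symplectic_points F pt"
    using exists_point_labelling by blast
  then interpret symplectic_points F pt .
  obtain U P where UP: "ovoid_of points orth U" "partition_on points P"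
    "\<And>T. T \<in> P \<Longrightarrow> line_of points orth T"
    using exists_ovoid exists_spread by blast
  obtain L where L: "line_of points orth L" using quadrangle.exists_line by blast
  have "card L \<le> card points"
    by (rule card_mono[OF finite_points quadrangle.line_subset[OF L]])
  then have "q < card points" using quadrangle.line_card[OF L] by simp
  then show ?thesis
    using finite_points quadrangle.primitive_G quadrangle.parameter_2[OF UP]
    by (intro exI[of _ points] exI[of _ "aut_group points orth"]) auto
qed

section \<open>Arbitrarily large fields by iterated quadratic extension\<close>

lemma even_finite_field_extend:
  fixes F :: "'k::alg_closed_field set"
  assumes "even_finite_field F"
  shows "\<exists>F' :: 'k set. even_finite_field F' \<and> card F < card F'"
proof -
  interpret even_finite_field F by fact
  obtain e where e: "e \<in> F" "\<And>a. a \<in> F \<Longrightarrow> a * a + a \<noteq> e" using irreducible_quadratic by blast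
  \<comment> \<open>The coefficients are \<open>e\<close>, 1, 1, so \<open>w\<close> is a root of
    t^2 + t + e and lies outside \<open>F\<close>.\<close>
  have "\<exists>w. (\<Sum>k\<le>2. (if k = 0 then e else 1) * w ^ k) = 0"
    by (rule alg_closed) auto
  then obtain w where "(\<Sum>k\<le>2. (if k = 0 then e else 1) * w ^ k) = 0" by blast
  then have "(w * w + w) + e = 0"
    by (simp add: numeral_2_eq_2 ac_simps)
  then have "w * w + w = e" by simp
  then have w: "w * w = w + e" "w \<notin> F"
    using e(2)[of w] add_self_left[of w "w * w"] by (auto simp: add.commute)
  \<comment> \<open>Coordinates on the quadratic extension with basis 1, \<open>w\<close>;
    injectivity gives it order \<open>q * q\<close>.\<close>
  define h where "h = (\<lambda>(a, b). a + b * w)"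
  have inj: "inj_on h (F \<times> F)"
  proof (rule inj_onI, clarify)
    fix a b c d assume F: "a \<in> F" "b \<in> F" "c \<in> F" "d \<in> F" and eq: "h (a, b) = h (c, d)"
    have "(b + d) * w + (a + c) = (a + b * w) + (c + d * w)" by (simp add: algebra_simps)
    also have "\<dots> = 0" using eq by (simp add: h_def)
    finally have *: "(b + d) * w = a + c" by simp
    have "b + d = 0"
    proof (rule ccontr)
      assume "b + d \<noteq> 0"
      then have "w = (a + c) / (b + d)" using * by (metis nonzero_mult_div_cancel_left)
      then show False using w F by simp
    qed
    moreover have "a + c = 0" using * calculation by simp
    ultimately show "a = c \<and> b = d" by simp
  qed
  have card: "card (h ` (F \<times> F)) = q * q"
    using inj by (simp add: card_image card_cartesian_product)
  have mem: "a + b * w \<in> h ` (F \<times> F)" if "a \<in> F" "b \<in> F" for a b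
    using that by (auto simp: h_def)
  have "even_finite_field (h ` (F \<times> F))"
  proof
    show "finite (h ` (F \<times> F))" using finite_F by simp
    show "0 \<in> h ` (F \<times> F)" "1 \<in> h ` (F \<times> F)" using mem[of 0 0] mem[of 1 0] by auto
    show "(1::'k) + 1 = 0" by (rule char_2)
    show "even (card (h ` (F \<times> F)))" using card card_even by simp
  next
    fix x y assume "x \<in> h ` (F \<times> F)" "y \<in> h ` (F \<times> F)"
    then obtain a b c d where F: "a \<in> F" "b \<in> F" "c \<in> F" "d \<in> F"
      and xy: "x = a + b * w" "y = c + d * w" by (auto simp: h_def)
    have "x + y = (a + c) + (b + d) * w" by (simp add: xy algebra_simps)
    then show "x + y \<in> h ` (F \<times> F)" using mem F by simp
    have "x * y = a * c + (a * d + b * c) * w + b * d * (w * w)"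
      by (simp only: xy distrib_left distrib_right ac_simps)
    also have "\<dots> = (a * c + b * d * e) + (a * d + b * c + b * d) * w"
      unfolding w(1) by (simp only: distrib_left distrib_right ac_simps)
    finally show "x * y \<in> h ` (F \<times> F)" using mem F e by simp
  qed
  moreover have "q < q * q" using q_ge_2 by simp
  ultimately show ?thesis using card by metis
qed

lemma even_finite_field_prime: "even_finite_field {0, 1 :: bit alg_closure}"
proof
  have "to_ac (1 + 1 :: bit) = 1 + 1" by (simp only: to_ac_add to_ac_1)
  moreover have "(1 + 1 :: bit) = 0" by simp
  ultimately show "(1 :: bit alg_closure) + 1 = 0" by simp
  then show "a + b \<in> {0, 1}" if "a \<in> {0, 1}" "b \<in> {0, 1}" for a b :: "bit alg_closure"
    using that by auto
qed auto

lemma large_even_finite_field: "\<exists>F :: bit alg_closure set. even_finite_field F \<and> n < card F"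
proof (induction n)
  case 0
  have "0 < card {0, 1 :: bit alg_closure}" by simp
  then show ?case using even_finite_field_prime by blast
next
  case (Suc n)
  then obtain F :: "bit alg_closure set" where F: "even_finite_field F" "n < card F" by blast
  then show ?case using even_finite_field_extend[OF F(1)] by (meson Suc_lessI less_trans_Suc order_less_le_trans Suc_leI)
qed

section \<open>Unbounded degrees give infinitely many isomorphism classes\<close>

theorem mainTheorem4:
  shows "infinite
    ({(X :: nat set, G). finite X \<and> primitive_perm_group X G \<and> non_synchronizing X G \<and>
        group_parameter X G = 2} // perm_iso_rel)"
proof
  let ?A = "{(X :: nat set, G). finite X \<and> primitive_perm_group X G \<and> non_synchronizing X G \<and>
        group_parameter X G = 2}"
  assume fin: "finite (?A // perm_iso_rel)"
  \<comment> \<open>The degree is constant on a class, so it may be read off an arbitrary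
    representative. Finitely many classes would bound it.\<close>
  define deg where "deg = (\<lambda>C :: (nat set \<times> (nat \<Rightarrow> nat) set) set. card (fst (SOME p. p \<in> C)))"
  have "finite (deg ` (?A // perm_iso_rel))" using fin by simp
  then obtain n where n: "\<And>C. C \<in> ?A // perm_iso_rel \<Longrightarrow> deg C \<le> n"
    by (metis (no_types, lifting) Max_ge image_eqI)
  obtain F :: "bit alg_closure set" where F: "even_finite_field F" "n < card F"
    using large_even_finite_field by blast
  obtain X :: "nat set" and G where XG: "finite X" "primitive_perm_group X G" "non_synchronizing X G"
    "group_parameter X G = 2" "card F < card X"
    using even_finite_field.exists_parameter_2_group[OF F(1)] by blast
  define C where "C = perm_iso_rel `` {(X, G)}"
  have C: "C \<in> ?A // perm_iso_rel" using XG unfolding C_def by (intro quotientI) auto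
  have "(X, G) \<in> C"
    using XG(2) perm_isomorphic_refl[of X G]
    by (auto simp: C_def perm_iso_rel_def primitive_perm_group_def)
  then have "(SOME p. p \<in> C) \<in> C" by (rule someI)
  then have "deg C = card X"
    by (auto simp: C_def perm_iso_rel_def perm_isomorphic_def deg_def split_beta dest: bij_betw_same_card)
  then show False using n[OF C] F(2) XG(5) by simp
qed

end
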